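(* Let $N \ge 1$ be an integer and let $p$ be a real number with $1<p<\infty$ and $p > N-1$. Then there exists a constant $C_{N,p} > 0$, depending only on $N$ and $p$, such that for every bounded domain $\Omega \subset \mathbb{R}^N$ whose boundary $\partial\Omega$ is connected, $$\lambda_{1,p}(\Omega) \geq C_{N,p}\, \rho_{\Omega}^{-p}.$$
   Context: A domain is a nonempty connected open set. For $1<p<\infty$ and a bounded domain $\Omega \subset \mathbb{R}^N$, $\lambda_{1,p}(\Omega)$ denotes the first eigenvalue of the Dirichlet $p$-Laplacian, i.e. of the problem $\operatorname{div}(|\nabla u|^{p-2}\nabla u) + \lambda |u|^{p-2}u = 0$ in $\Omega$, $u \in W^{1,p}_0(\Omega)$ (weak sense). It is characterized variationally by $$\lambda_{1,p}(\Omega) = \inf_{0 \neq u\in C^\infty_0(\Omega)} \frac{ \int_\Omega |\nabla u|^p \, dx}{\int_\Omega |u|^p \, dx},$$ the infimum being attained by a function in $W^{1,p}_0(\Omega)$. The inradius of $\Omega$ is $\rho_\Omega := \sup\{ r > 0 : \text{there is an open ball } B_r \text{ of radius } r \text{ with } B_r \subset \Omega\}$. *)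

theory Defs
  imports "HOL-Analysis.Analysis"
begin

fun C_k :: "nat \<Rightarrow> (real ^ 'n \<Rightarrow> real) \<Rightarrow> bool" where
  "C_k 0 f \<longleftrightarrow> continuous_on UNIV f"
| "C_k (Suc k) f \<longleftrightarrow>
     (\<forall>x. f differentiable (at x)) \<and>
     (\<forall>i. C_k k (\<lambda>x. frechet_derivative f (at x) (axis i 1)))"

text \<open>A function in \<open>C_0^\<infinity>(\<Omega>)\<close> is represented by its extension by zero to the whole space.\<close>

definition test_function :: "(real ^ 'n) set \<Rightarrow> (real ^ 'n \<Rightarrow> real) \<Rightarrow> bool" where
  "test_function \<Omega> \<phi> \<longleftrightarrow>
     (\<forall>k. C_k k \<phi>) \<and> compact (closure {x. \<phi> x \<noteq> 0}) \<and> closure {x. \<phi> x \<noteq> 0} \<subseteq> \<Omega>"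

definition grad :: "(real ^ 'n \<Rightarrow> real) \<Rightarrow> real ^ 'n \<Rightarrow> real ^ 'n" where
  "grad f x = (\<chi> i. frechet_derivative f (at x) (axis i 1))"

definition Lp_on :: "real \<Rightarrow> (real ^ 'n) set \<Rightarrow> (real ^ 'n \<Rightarrow> 'b::euclidean_space) \<Rightarrow> bool" where
  "Lp_on p \<Omega> f \<longleftrightarrow>
     set_borel_measurable lebesgue \<Omega> f \<and>
     set_integrable lebesgue \<Omega> (\<lambda>x. norm (f x) powr p)"

definition weak_gradient ::
  "(real ^ 'n) set \<Rightarrow> (real ^ 'n \<Rightarrow> real) \<Rightarrow> (real ^ 'n \<Rightarrow> real ^ 'n) \<Rightarrow> bool" where
  "weak_gradient \<Omega> u G \<longleftrightarrow>
     (\<forall>\<phi>. test_function \<Omega> \<phi> \<longrightarrow>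
        (LINT x:\<Omega>|lebesgue. u x *\<^sub>R grad \<phi> x) = - (LINT x:\<Omega>|lebesgue. \<phi> x *\<^sub>R G x))"

text \<open>\<open>W1p p \<Omega> u G\<close> means that \<open>u\<close> lies in \<open>W\<^sup>1\<^sup>,\<^sup>p(\<Omega>)\<close> and has weak gradient \<open>G\<close>; the latter is
  unique up to a null set. \<open>W01p\<close> is the closure of the test functions in the Sobolev norm.\<close>

definition W1p ::
  "real \<Rightarrow> (real ^ 'n) set \<Rightarrow> (real ^ 'n \<Rightarrow> real) \<Rightarrow> (real ^ 'n \<Rightarrow> real ^ 'n) \<Rightarrow> bool" where
  "W1p p \<Omega> u G \<longleftrightarrow> Lp_on p \<Omega> u \<and> Lp_on p \<Omega> G \<and> weak_gradient \<Omega> u G"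

definition W01p ::
  "real \<Rightarrow> (real ^ 'n) set \<Rightarrow> (real ^ 'n \<Rightarrow> real) \<Rightarrow> (real ^ 'n \<Rightarrow> real ^ 'n) \<Rightarrow> bool" where
  "W01p p \<Omega> u G \<longleftrightarrow> W1p p \<Omega> u G \<and>
     (\<exists>\<phi>. (\<forall>n. test_function \<Omega> (\<phi> n)) \<and>
        (\<lambda>n::nat. LINT x:\<Omega>|lebesgue. \<bar>\<phi> n x - u x\<bar> powr p) \<longlonglongrightarrow> 0 \<and>
        (\<lambda>n::nat. LINT x:\<Omega>|lebesgue. norm (grad (\<phi> n) x - G x) powr p) \<longlonglongrightarrow> 0)"

text \<open>Weak form of \<open>div(|\<nabla>u|\<^sup>p\<^sup>-\<^sup>2 \<nabla>u) + \<lambda> |u|\<^sup>p\<^sup>-\<^sup>2 u = 0\<close> for a nonzero \<open>u\<close>. Since \<open>0 powr a = 0\<close>, the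
  products below vanish at zeros of \<open>G\<close> and \<open>u\<close> also for \<open>p < 2\<close>, as the usual convention demands.\<close>

definition dirichlet_eigenvalue :: "real \<Rightarrow> (real ^ 'n) set \<Rightarrow> real \<Rightarrow> bool" where
  "dirichlet_eigenvalue p \<Omega> l \<longleftrightarrow>
     (\<exists>u G. W01p p \<Omega> u G \<and> \<not> (AE x in lebesgue. x \<in> \<Omega> \<longrightarrow> u x = 0) \<and>
        (\<forall>\<phi>. test_function \<Omega> \<phi> \<longrightarrow>
           (LINT x:\<Omega>|lebesgue. norm (G x) powr (p - 2) * (G x \<bullet> grad \<phi> x)) =
           l * (LINT x:\<Omega>|lebesgue. \<bar>u x\<bar> powr (p - 2) * u x * \<phi> x)))"

text \<open>The smallest Dirichlet eigenvalue. For a bounded domain and \<open>1 < p < \<infinity>\<close> eigenvalues exist and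
  this infimum is attained, so it is a real number; extended reals only make it total.\<close>

definition first_eigenvalue :: "real \<Rightarrow> (real ^ 'n) set \<Rightarrow> ereal" where
  "first_eigenvalue p \<Omega> = (INF l\<in>{l. dirichlet_eigenvalue p \<Omega> l}. ereal l)"

definition inradius :: "(real ^ 'n) set \<Rightarrow> real" where
  "inradius \<Omega> = Sup {r. 0 < r \<and> (\<exists>x. ball x r \<subseteq> \<Omega>)}"

definition domain :: "(real ^ 'n) set \<Rightarrow> bool" where
  "domain \<Omega> \<longleftrightarrow> \<Omega> \<noteq> {} \<and> open \<Omega> \<and> connected \<Omega>"

end

theory Submission
  imports Defs
begin

text \<open>Testing the eigenvalue equation with approximants of the eigenfunction gives
  \<open>\<integral> |G|\<^sup>p = l \<integral> |u|\<^sup>p\<close>, so it suffices to bound \<open>\<integral> |f|\<^sup>p\<close> by \<open>K \<rho>\<^sup>p \<integral> |\<nabla>f|\<^sup>p\<close> for test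
  functions \<open>f\<close>, where \<open>\<rho>\<close> is the inradius.

  Consider a cube \<open>Q\<close> of half-width \<open>3\<rho>\<close>. If a slice \<open>x $ i = s\<close> of \<open>Q\<close> contains a zero \<open>z\<close> of \<open>f\<close>,
  integrate \<open>\<nabla>f\<close> along the curves \<open>z + t\<^sup>m (x - z)\<close> within the slice. Undoing the contraction by
  \<open>u = t\<^sup>m\<close> costs the Jacobian \<open>u\<^sup>1\<^sup>-\<^sup>N\<close>; because \<open>p > N - 1\<close>, for large \<open>m\<close> it is absorbed by the
  \<open>p\<close>-th power of the speed \<open>m t\<^sup>m\<^sup>-\<^sup>1 |x - z|\<close>. So \<open>\<nabla>f\<close> on the slice controls \<open>f\<close> on the slice, and
  integration in direction \<open>i\<close> then controls \<open>f\<close> on \<open>Q\<close>. The frontier of \<open>\<Omega>\<close> is connected, has extent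
  at least \<open>2\<rho>\<close> and passes near the centre of \<open>Q\<close> (unless \<open>f\<close> vanishes there), so a positive
  proportion of the slices in some direction contain a zero. Finally one averages over all
  translates of \<open>Q\<close>.\<close>

section \<open>Powers and one-dimensional estimates\<close>

text \<open>Young's inequality for \<open>y\<close> and \<open>c powr (p - 1)\<close>, with
  conjugate exponents \<open>p\<close> and \<open>p / (p - 1)\<close>, rearranges to the tangent
  line at \<open>c\<close>.\<close>

lemma powr_ge_tangent:
  fixes y c p :: real
  assumes "1 < p" "0 \<le> y" "0 < c"
  shows "c powr p + p * c powr (p - 1) * (y - c) \<le> y powr p"
proof -
  have "y * c powr (p - 1) \<le> y powr p / p + (c powr (p - 1)) powr (p / (p - 1)) / (p / (p - 1))"
    using assms by (intro Youngs_inequality) (auto simp: field_simps)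
  moreover have "(c powr (p - 1)) powr (p / (p - 1)) = c powr p"
    using assms by (simp add: powr_powr)
  ultimately have "y * c powr (p - 1) \<le> y powr p / p + c powr p * (p - 1) / p"
    using assms by simp
  then have "p * (y * c powr (p - 1)) \<le> p * (y powr p / p + c powr p * (p - 1) / p)"
    using assms by (intro mult_left_mono) auto
  also have "\<dots> = y powr p + c powr p * (p - 1)"
    using assms by (simp add: field_simps)
  finally have "p * (y * c powr (p - 1)) \<le> y powr p + c powr p * (p - 1)" .
  moreover have "c powr p = c * c powr (p - 1)"
    using assms by (simp add: powr_diff)
  ultimately show ?thesis by (simp add: algebra_simps)
qed

text \<open>Both norms are at most their maximum, which gives the crude constant
  \<open>2 powr p\<close> for every \<open>p \<ge> 0\<close>.\<close>

lemma norm_add_powr_le: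
  fixes a b :: "'a :: real_normed_vector"
  assumes "0 \<le> p"
  shows "norm (a + b) powr p \<le> 2 powr p * (norm a powr p + norm b powr p)"
proof -
  let ?M = "max (norm a) (norm b)"
  have "norm (a + b) \<le> 2 * ?M" using norm_triangle_ineq[of a b] by linarith
  then have "norm (a + b) powr p \<le> (2 * ?M) powr p" using assms by (intro powr_mono2) auto
  also have "\<dots> = 2 powr p * ?M powr p" by (simp add: powr_mult)
  also have "\<dots> \<le> 2 powr p * (norm a powr p + norm b powr p)"
    by (intro mult_left_mono) (auto simp: max_def)
  finally show ?thesis .
qed

text \<open>Jensen's inequality: integrate the tangent line of the power function at the mean of
  \<open>g\<close>.\<close>

lemma integral_powr_le:
  fixes g :: "real \<Rightarrow> real"
  assumes p: "1 < p" and ab: "a \<le> b" and g: "continuous_on {a..b} g" "\<And>x. 0 \<le> g x"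
  shows "(integral {a..b} g) powr p \<le> (b - a) powr (p - 1) * integral {a..b} (\<lambda>x. g x powr p)"
proof -
  let ?I = "integral {a..b} g"
  have gi: "g integrable_on {a..b}" using g(1) by (rule integrable_continuous_real)
  have gpi: "(\<lambda>x. g x powr p) integrable_on {a..b}"
    using g p by (intro integrable_continuous_real continuous_on_powr') auto
  have I0: "0 \<le> ?I" using gi g by (intro integral_nonneg) auto
  have P0: "0 \<le> integral {a..b} (\<lambda>x. g x powr p)" using gpi by (intro integral_nonneg) auto
  show ?thesis
  \<comment> \<open>The tangent estimate asks for a positive base point, so a vanishing mean is
    treated apart.\<close>
  proof (cases "?I = 0")
    case True then show ?thesis using p P0 by simp
  next
    case False
    then have ab': "a < b" using ab by (cases "a = b") auto
    define c where "c = ?I / (b - a)"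
    have c: "c > 0" using False I0 ab' by (simp add: c_def)
    have "integral {a..b} (\<lambda>x. c powr p + p * c powr (p - 1) * (g x - c)) \<le> integral {a..b} (\<lambda>x. g x powr p)"
      using gpi gi powr_ge_tangent[OF p g(2) c]
      by (intro integral_le integrable_add integrable_on_mult_right integrable_diff) auto
    also have "integral {a..b} (\<lambda>x. c powr p + p * c powr (p - 1) * (g x - c))
        = (b - a) * c powr p + p * c powr (p - 1) * (?I - (b - a) * c)"
    proof -
      have const: "((\<lambda>x. r) has_integral ((b - a) * r)) {a..b}" for r
        using has_integral_const_real[of r a b] ab by simp
      have "((\<lambda>x. c powr p + p * c powr (p - 1) * (g x - c)) has_integral
          ((b - a) * (c powr p) + p * c powr (p - 1) * (?I - (b - a) * c))) {a..b}"
        by (intro has_integral_add has_integral_mult_right has_integral_diff integrable_integral const gi)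
      then show ?thesis by (simp add: integral_unique)
    qed
    \<comment> \<open>The linear term integrates to zero because \<open>c\<close> is the mean of
      \<open>g\<close>.\<close>
    also have "\<dots> = (b - a) * c powr p" using ab' by (simp add: c_def)
    finally have "(b - a) powr (p - 1) * ((b - a) * c powr p) \<le> (b - a) powr (p - 1) * integral {a..b} (\<lambda>x. g x powr p)"
      by (intro mult_left_mono) auto
    moreover have "(b - a) powr (p - 1) * ((b - a) * c powr p) = ((b - a) * c) powr p"
      using ab' c by (simp add: powr_mult powr_diff)
    moreover have "(b - a) * c = ?I" using ab' by (simp add: c_def)
    ultimately show ?thesis by simp
  qed
qed

text \<open>The fundamental theorem of calculus followed by Jensen. The integral runs over all of
  \<open>{a..b}\<close>, so the bound is independent of \<open>s\<close> and \<open>t\<close>; it is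
  an extended nonnegative integral, ready for Tonelli.\<close>

lemma increment_powr_le:
  fixes f f' :: "real \<Rightarrow> real"
  assumes p: "1 < p" and st: "s \<in> {a..b}" "t \<in> {a..b}"
    and f: "\<And>x. x \<in> {a..b} \<Longrightarrow> (f has_field_derivative f' x) (at x)"
    and f': "continuous_on {a..b} f'"
  shows "ennreal (\<bar>f t - f s\<bar> powr p)
    \<le> ennreal ((b - a) powr (p - 1)) * (\<integral>\<^sup>+x\<in>{a..b}. ennreal (\<bar>f' x\<bar> powr p) \<partial>lborel)"
proof -
  have *: "\<bar>f t - f s\<bar> \<le> integral {a..b} (\<lambda>x. \<bar>f' x\<bar>)" if st: "s \<in> {a..b}" "t \<in> {a..b}" "s \<le> t" for s t
  proof -
    have sub: "{s..t} \<subseteq> {a..b}" using st by auto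
    have "(f' has_integral (f t - f s)) {s..t}"
    proof (intro fundamental_theorem_of_calculus)
      fix x assume "x \<in> {s..t}"
      then have "(f has_field_derivative f' x) (at x within {s..t})"
        using sub by (intro has_field_derivative_at_within[OF f]) auto
      then show "(f has_vector_derivative f' x) (at x within {s..t})"
        by (simp add: has_real_derivative_iff_has_vector_derivative)
    qed (use st in auto)
    then have "\<bar>f t - f s\<bar> = \<bar>integral {s..t} f'\<bar>" by (simp add: integral_unique)
    also have "\<dots> \<le> integral {s..t} (\<lambda>x. \<bar>f' x\<bar>)"
      using continuous_on_subset[OF f' sub]
      using integral_norm_bound_integral[of f' "{s..t}" "\<lambda>x. \<bar>f' x\<bar>"]
      by (auto intro!: integrable_continuous_real continuous_intros)
    also have "\<dots> \<le> integral {a..b} (\<lambda>x. \<bar>f' x\<bar>)"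
      using continuous_on_subset[OF f' sub] f' sub
      by (intro integral_subset_le integrable_continuous_real continuous_intros) auto
    finally show ?thesis .
  qed
  have le: "\<bar>f t - f s\<bar> \<le> integral {a..b} (\<lambda>x. \<bar>f' x\<bar>)"
    using *[of s t] *[of t s] st by (cases "s \<le> t") (auto simp: abs_minus_commute)
  have ab: "a \<le> b" using st by auto
  have cont: "continuous_on {a..b} (\<lambda>x. \<bar>f' x\<bar> powr p)"
    using f' p by (intro continuous_on_powr' continuous_intros) auto
  have "\<bar>f t - f s\<bar> powr p \<le> (integral {a..b} (\<lambda>x. \<bar>f' x\<bar>)) powr p"
    using le p by (intro powr_mono2) auto
  also have "\<dots> \<le> (b - a) powr (p - 1) * integral {a..b} (\<lambda>x. \<bar>f' x\<bar> powr p)"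
    using f' by (intro integral_powr_le p ab continuous_intros) auto
  finally have "ennreal (\<bar>f t - f s\<bar> powr p) \<le> ennreal ((b - a) powr (p - 1) * integral {a..b} (\<lambda>x. \<bar>f' x\<bar> powr p))"
    by (rule ennreal_leI)
  also have "\<dots> = ennreal ((b - a) powr (p - 1)) * ennreal (integral {a..b} (\<lambda>x. \<bar>f' x\<bar> powr p))"
    by (simp add: ennreal_mult')
  also have "ennreal (integral {a..b} (\<lambda>x. \<bar>f' x\<bar> powr p)) = (\<integral>\<^sup>+x\<in>{a..b}. ennreal (\<bar>f' x\<bar> powr p) \<partial>lborel)"
  proof -
    have "integral\<^sup>N lborel (\<lambda>x. ennreal (indicator {a..b} x * \<bar>f' x\<bar> powr p)) = ennreal (integral {a..b} (\<lambda>x. \<bar>f' x\<bar> powr p))"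
      using cont by (intro nn_integral_has_integral_lebesgue integrable_integral integrable_continuous_real) auto
    moreover have "ennreal (indicator {a..b} x * \<bar>f' x\<bar> powr p) = ennreal (\<bar>f' x\<bar> powr p) * indicator {a..b} x" for x
      by (auto simp: indicator_def)
    ultimately show ?thesis by simp
  qed
  finally show ?thesis .
qed

section \<open>Slices of cubes\<close>

text \<open>Projects \<open>x\<close> onto the slice with coordinate \<open>i\<close> equal to
  \<open>s\<close>. Slices are thus parametrized by the full cube, with coordinate \<open>i\<close>
  as a dummy variable, and slice integrals are taken with the ordinary N-dimensional
  measure.\<close>

definition upd :: "real ^ 'n \<Rightarrow> 'n \<Rightarrow> real \<Rightarrow> real ^ 'n" where
  "upd x i s = (\<chi> j. if j = i then s else x $ j)"

lemma upd_nth [simp]: "upd x i s $ j = (if j = i then s else x $ j)"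
  by (simp add: upd_def)

lemma upd_triv: "upd x i (x $ i) = x"
  by (simp add: vec_eq_iff)

lemma upd_eq: "upd x i s = x + (s - x $ i) *\<^sub>R axis i 1"
  by (simp add: vec_eq_iff axis_def)

lemma continuous_on_upd [continuous_intros]:
  assumes "continuous_on A f" "continuous_on A g"
  shows "continuous_on A (\<lambda>x. upd (f x) i (g x))"
  unfolding upd_eq using assms by (intro continuous_intros)

lemma borel_measurable_upd [measurable]:
  fixes f :: "'a \<Rightarrow> real ^ 'n"
  assumes [measurable]: "f \<in> borel_measurable M" "g \<in> borel_measurable M"
  shows "(\<lambda>x. upd (f x) i (g x)) \<in> borel_measurable M"
proof -
  have "(\<lambda>x. f x \<bullet> axis i 1) \<in> borel_measurable M" by measurable
  then have [measurable]: "(\<lambda>x. f x $ i) \<in> borel_measurable M" by (simp add: cart_eq_inner_axis)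
  show ?thesis unfolding upd_eq by measurable
qed

section \<open>Cubes and contractions of their slices\<close>

definition cube :: "real \<Rightarrow> (real ^ 'n) set" where
  "cube L = {x. \<forall>i. \<bar>x $ i\<bar> \<le> L}"

lemma cube_eq: "cube L = cbox (\<chi> i. - L) (\<chi> i. L)"
  by (auto simp: cube_def mem_box_cart abs_le_iff minus_le_iff)

lemma cube_borel [measurable]: "cube L \<in> sets borel"
  by (simp add: cube_eq)

lemma emeasure_cube:
  assumes "0 \<le> L"
  shows "emeasure lborel (cube L :: (real ^ 'n) set) = ennreal ((2 * L) ^ CARD('n))"
proof -
  have Basis: "(Basis :: (real ^ 'n) set) = range (\<lambda>i. axis i 1)"
    by (auto simp: Basis_vec_def)
  have inj: "inj (\<lambda>i :: 'n. axis i (1::real))"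
    by (auto simp: inj_on_def axis_eq_axis)
  have "(\<Prod>b\<in>Basis. ((\<chi> i. L) - (\<chi> i. - L) :: real ^ 'n) \<bullet> b) = (\<Prod>i\<in>(UNIV :: 'n set). 2 * L)"
    unfolding Basis prod.reindex[OF inj] o_def by (intro prod.cong) (auto simp: inner_axis)
  moreover have "\<And>b. b \<in> Basis \<Longrightarrow> (\<chi> i. - L :: real ^ 'n) \<bullet> b \<le> (\<chi> i. L) \<bullet> b"
    using assms by (auto simp: Basis inner_axis)
  ultimately show ?thesis
    unfolding cube_eq by (simp only: emeasure_lborel_cbox prod_constant)
qed

lemma cube_dist:
  assumes "x \<in> cube L" "y \<in> cube L"
  shows "norm (x - y :: real ^ 'n) \<le> 2 * L * CARD('n)"
proof -
  have "norm (x - y) \<le> (\<Sum>i\<in>UNIV. \<bar>(x - y) $ i\<bar>)" by (rule norm_le_l1_cart)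
  also have "\<dots> \<le> (\<Sum>i\<in>(UNIV :: 'n set). 2 * L)"
  proof (intro sum_mono)
    fix i show "\<bar>(x - y) $ i\<bar> \<le> 2 * L"
      using spec[OF assms(1)[unfolded cube_def mem_Collect_eq], of i] spec[OF assms(2)[unfolded cube_def mem_Collect_eq], of i]
      by simp
  qed
  finally show ?thesis by (simp add: mult.commute)
qed

text \<open>The exponent is \<open>CARD('n) - 1\<close> because the substitution leaves coordinate \<open>i\<close> unscaled.\<close>

lemma nn_integral_slice_contract:
  fixes k :: "real ^ 'n \<Rightarrow> ennreal"
  assumes k [measurable]: "k \<in> borel_measurable borel" and u: "0 < u" "u \<le> 1"
    and z: "z \<in> cube L" "z $ i = s"
  shows "ennreal (u ^ (CARD('n) - 1)) * (\<integral>\<^sup>+x\<in>cube L. k (z + u *\<^sub>R (upd x i s - z)) \<partial>lborel)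
    \<le> (\<integral>\<^sup>+x\<in>cube L. k (upd x i s) \<partial>lborel)"
proof -
  \<comment> \<open>\<open>T\<close> contracts towards \<open>z\<close> by the factor
    \<open>u\<close> in every coordinate but \<open>i\<close>, which it fixes; \<open>c\<close>
    lists its diagonal entries.\<close>
  define c :: "real ^ 'n \<Rightarrow> real" where "c = (\<lambda>j. if j = axis i 1 then 1 else u)"
  define T :: "real ^ 'n \<Rightarrow> real ^ 'n" where
    "T = (\<lambda>x. upd ((1 - u) *\<^sub>R z) i 0 + (\<Sum>j\<in>Basis. (c j * (x \<bullet> j)) *\<^sub>R j))"
  have Basis: "(Basis :: (real ^ 'n) set) = range (\<lambda>i. axis i 1)"
    by (auto simp: Basis_vec_def)
  have inj: "inj (\<lambda>i :: 'n. axis i (1::real))"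
    by (auto simp: inj_on_def axis_eq_axis)
  have T_nth: "T x $ j = (if j = i then x $ i else z $ j + u * (x $ j - z $ j))" for x j
  proof -
    have "(\<Sum>j\<in>Basis. (c j * (x \<bullet> j)) *\<^sub>R j) = (\<Sum>j\<in>UNIV. (c (axis j 1) * (x $ j)) *\<^sub>R axis j 1)"
      unfolding Basis by (subst sum.reindex[OF inj]) (simp add: cart_eq_inner_axis)
    also have "\<dots> $ j = (\<Sum>l\<in>UNIV. if l = j then c (axis j 1) * x $ j else 0)"
      unfolding sum_component by (intro sum.cong) (auto simp: axis_def)
    also have "\<dots> = c (axis j 1) * x $ j" by simp
    finally show ?thesis
      by (auto simp: T_def c_def axis_eq_axis algebra_simps)
  qed
  have prod: "(\<Prod>j\<in>Basis. \<bar>c j\<bar>) = u ^ (CARD('n) - 1)"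
  proof -
    have "(\<Prod>j\<in>Basis. \<bar>c j\<bar>) = (\<Prod>j\<in>UNIV. \<bar>c (axis j 1)\<bar>)"
      unfolding Basis by (subst prod.reindex[OF inj]) simp
    also have "\<dots> = (\<Prod>j\<in>UNIV. if j = i then 1 else u)"
      using u by (intro prod.cong) (auto simp: c_def axis_eq_axis)
    also have "\<dots> = (\<Prod>j\<in>UNIV - {i}. if j = i then 1 else u)"
      by (subst prod.remove[of UNIV i]) auto
    also have "\<dots> = (\<Prod>j\<in>UNIV - {i}. u)" by (intro prod.cong) auto
    finally show ?thesis by (simp add: card_Diff_singleton)
  qed
  have [measurable]: "T \<in> borel_measurable borel"
    unfolding T_def by measurable
  have upd_T: "upd (T x) i s = z + u *\<^sub>R (upd x i s - z)" for x
    using z(2) by (simp add: vec_eq_iff T_nth)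
  \<comment> \<open>The cube is convex and contains \<open>z\<close>, so \<open>T\<close> maps it
    into itself.\<close>
  have cube: "T x \<in> cube L" if "x \<in> cube L" for x
  proof -
    have "\<bar>z $ j + u * (x $ j - z $ j)\<bar> \<le> L" for j
    proof -
      have "z $ j + u * (x $ j - z $ j) = (1 - u) * z $ j + u * x $ j" by (simp add: algebra_simps)
      also have "\<bar>\<dots>\<bar> \<le> (1 - u) * \<bar>z $ j\<bar> + u * \<bar>x $ j\<bar>"
        using u by (simp add: abs_mult order_trans[OF abs_triangle_ineq])
      also have "\<dots> \<le> (1 - u) * L + u * L"
        using u z(1) that by (intro add_mono mult_left_mono) (auto simp: cube_def)
      finally show ?thesis by (simp add: algebra_simps)
    qed
    then show ?thesis using that by (auto simp: cube_def T_nth)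
  qed
  have "(\<integral>\<^sup>+x\<in>cube L. k (upd x i s) \<partial>lborel)
      = (\<integral>\<^sup>+x\<in>cube L. k (upd x i s) \<partial>density (distr lborel borel T) (\<lambda>_. (\<Prod>j\<in>Basis. \<bar>c j\<bar>)))"
    unfolding T_def using u by (subst lborel_affine_euclidean[of c]) (auto simp: c_def)
  also have "\<dots> = ennreal (u ^ (CARD('n) - 1)) * (\<integral>\<^sup>+x. k (upd (T x) i s) * indicator (cube L) (T x) \<partial>lborel)"
    unfolding prod by (simp add: nn_integral_density nn_integral_distr nn_integral_cmult)
  \<comment> \<open>Only an inequality: the image of the cube under \<open>T\<close> may be a proper
    part of the cube.\<close>
  also have "\<dots> \<ge> ennreal (u ^ (CARD('n) - 1)) * (\<integral>\<^sup>+x\<in>cube L. k (upd (T x) i s) \<partial>lborel)"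
    using cube by (intro mult_left_mono nn_integral_mono) (auto simp: indicator_def)
  finally show ?thesis by (simp add: upd_T)
qed

lemma cube_upd: "x \<in> cube L \<Longrightarrow> \<bar>s\<bar> \<le> L \<Longrightarrow> upd x i s \<in> cube L"
  by (simp add: cube_def)

text \<open>The condition on \<open>m\<close> says \<open>m (N - 1) \<le> (m - 1) p\<close>: the
  \<open>p\<close>-th power of the speed factor \<open>t ^ (m - 1)\<close> is at most the Jacobian
  \<open>(t ^ m) ^ (N - 1)\<close> of the contraction, where N is \<open>CARD('n)\<close>. In the
  constant, \<open>m\<close> comes from the speed and \<open>2 * L * CARD('n)\<close> bounds the
  diameter of the cube.\<close>

lemma nn_integral_slice_le:
  fixes F :: "real ^ 'n \<Rightarrow> real" and G :: "real ^ 'n \<Rightarrow> real ^ 'n"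
  assumes p: "1 < p" and m: "2 \<le> m" "p \<le> real m * (p - (real CARD('n) - 1))"
    and F: "\<And>x. (F has_derivative (\<lambda>h. G x \<bullet> h)) (at x)"
    and G: "continuous_on UNIV G"
    and z: "z \<in> cube L" "z $ i = s" "F z = 0" and L: "0 \<le> L"
  shows "(\<integral>\<^sup>+x\<in>cube L. ennreal (\<bar>F (upd x i s)\<bar> powr p) \<partial>lborel)
    \<le> ennreal ((real m * (2 * L * CARD('n))) powr p)
       * (\<integral>\<^sup>+x\<in>cube L. ennreal (norm (G (upd x i s)) powr p) \<partial>lborel)"
proof -
  define D where "D = 2 * L * CARD('n)"
  have D: "0 \<le> D" using L by (simp add: D_def)
  define k where "k = (\<lambda>x. ennreal (norm (G x) powr p))"
  have G_borel [measurable]: "G \<in> borel_measurable borel"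
    using G by (rule borel_measurable_continuous_onI)
  have k_borel [measurable]: "k \<in> borel_measurable borel"
    unfolding k_def by measurable
  let ?c = "ennreal ((real m * D) powr p)"
  let ?R = "\<integral>\<^sup>+x\<in>cube L. k (upd x i s) \<partial>lborel"
  have s: "\<bar>s\<bar> \<le> L" using z by (auto simp: cube_def)
  \<comment> \<open>The curve from the zero \<open>z\<close> at \<open>t = 0\<close> to
    \<open>upd x i s\<close> at \<open>t = 1\<close> stays in the slice, since both ends have
    coordinate \<open>i\<close> equal to \<open>s\<close>.\<close>
  have pt: "ennreal (\<bar>F (upd x i s)\<bar> powr p)
      \<le> (\<integral>\<^sup>+t\<in>{0..1}. ?c * (ennreal ((t ^ (m - 1)) powr p) * k (z + t ^ m *\<^sub>R (upd x i s - z))) \<partial>lborel)"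
    if x: "x \<in> cube L" for x
  proof -
    define v where "v = upd x i s - z"
    have v: "norm v \<le> D"
      unfolding v_def D_def using cube_upd[OF x s] z by (intro cube_dist)
    define f' where "f' = (\<lambda>t. G (z + t ^ m *\<^sub>R v) \<bullet> ((real m * t ^ (m - 1)) *\<^sub>R v))"
    have der: "((\<lambda>t. F (z + t ^ m *\<^sub>R v)) has_field_derivative f' t) (at t)" for t
    proof -
      have "((\<lambda>t. z + t ^ m *\<^sub>R v) has_derivative (\<lambda>h. (h * (real m * t ^ (m - 1))) *\<^sub>R v)) (at t)"
        by (auto intro!: derivative_eq_intros)
      from has_derivative_compose[OF this F]
      show ?thesis
        unfolding has_field_derivative_def by (rule has_derivative_eq_rhs) (auto simp: f'_def mult_ac)
    qed
    have cont: "continuous_on {0..1} f'"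
      unfolding f'_def
      by (intro continuous_intros continuous_on_compose2[OF G]) auto
    have "ennreal (\<bar>F (z + 1 ^ m *\<^sub>R v) - F (z + 0 ^ m *\<^sub>R v)\<bar> powr p)
        \<le> ennreal ((1 - 0) powr (p - 1)) * (\<integral>\<^sup>+t\<in>{0..1}. ennreal (\<bar>f' t\<bar> powr p) \<partial>lborel)"
      using der cont by (intro increment_powr_le[OF p]) auto
    then have "ennreal (\<bar>F (upd x i s)\<bar> powr p) \<le> (\<integral>\<^sup>+t\<in>{0..1}. ennreal (\<bar>f' t\<bar> powr p) \<partial>lborel)"
      using m z by (simp add: v_def power_0_left)
    also have "\<dots> \<le> (\<integral>\<^sup>+t\<in>{0..1}. ?c * (ennreal ((t ^ (m - 1)) powr p) * k (z + t ^ m *\<^sub>R v)) \<partial>lborel)"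
    proof (intro nn_integral_mono)
      fix t :: real
      have "\<bar>f' t\<bar> powr p \<le> (real m * D) powr p * ((t ^ (m - 1)) powr p * norm (G (z + t ^ m *\<^sub>R v)) powr p)"
        if t: "t \<in> {0..1}"
      proof -
        have "\<bar>f' t\<bar> \<le> norm (G (z + t ^ m *\<^sub>R v)) * norm ((real m * t ^ (m - 1)) *\<^sub>R v)"
          unfolding f'_def by (rule Cauchy_Schwarz_ineq2)
        also have "\<dots> \<le> norm (G (z + t ^ m *\<^sub>R v)) * ((real m * t ^ (m - 1)) * D)"
          using t v by (auto intro!: mult_left_mono)
        finally have "\<bar>f' t\<bar> powr p \<le> ((real m * D) * (t ^ (m - 1) * norm (G (z + t ^ m *\<^sub>R v)))) powr p"
          using p by (intro powr_mono2) (auto simp: mult_ac)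
        then show ?thesis using t D by (simp add: powr_mult)
      qed
      then have "ennreal (\<bar>f' t\<bar> powr p) \<le> ?c * (ennreal ((t ^ (m - 1)) powr p) * k (z + t ^ m *\<^sub>R v))"
        if "t \<in> {0..1}"
        using that by (simp add: k_def ennreal_leI flip: ennreal_mult)
      then show "ennreal (\<bar>f' t\<bar> powr p) * indicator {0..1} t
          \<le> ?c * (ennreal ((t ^ (m - 1)) powr p) * k (z + t ^ m *\<^sub>R v)) * indicator {0..1} t"
        by (auto simp: indicator_def)
    qed
    finally show ?thesis unfolding v_def .
  qed
  \<comment> \<open>A bound uniform in \<open>t\<close>. At \<open>t = 0\<close> the contraction
    degenerates, but there the weight vanishes because \<open>m \<ge> 2\<close>.\<close>
  have inner: "ennreal ((t ^ (m - 1)) powr p) * (\<integral>\<^sup>+x\<in>cube L. k (z + t ^ m *\<^sub>R (upd x i s - z)) \<partial>lborel) \<le> ?R"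
    if t: "t \<in> {0..1}" for t
  proof (cases "t = 0")
    case True then show ?thesis using m by (simp add: power_0_left)
  next
    case False
    then have t: "0 < t" "t \<le> 1" using t by auto
    have "(t ^ (m - 1)) powr p = t powr (real (m - 1) * p)"
      using t by (simp add: powr_powr flip: powr_realpow)
    \<comment> \<open>Since \<open>t \<le> 1\<close>, the larger exponent \<open>(m - 1) p\<close>
      gives the smaller power.\<close>
    also have "\<dots> \<le> t powr (real m * real (CARD('n) - 1))"
      using t m by (intro powr_mono') (auto simp: algebra_simps of_nat_diff Suc_leI)
    also have "\<dots> = (t ^ m) ^ (CARD('n) - 1)"
      using t powr_realpow[of t "m * (CARD('n) - 1)"] by (simp only: power_mult of_nat_mult)
    finally have "ennreal ((t ^ (m - 1)) powr p) * (\<integral>\<^sup>+x\<in>cube L. k (z + t ^ m *\<^sub>R (upd x i s - z)) \<partial>lborel)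
        \<le> ennreal ((t ^ m) ^ (CARD('n) - 1)) * (\<integral>\<^sup>+x\<in>cube L. k (z + t ^ m *\<^sub>R (upd x i s - z)) \<partial>lborel)"
      by (intro mult_right_mono ennreal_leI) auto
    also have "\<dots> \<le> ?R"
      using t z by (intro nn_integral_slice_contract) (auto simp: power_le_one)
    finally show ?thesis .
  qed
  have "(\<integral>\<^sup>+x\<in>cube L. ennreal (\<bar>F (upd x i s)\<bar> powr p) \<partial>lborel)
     \<le> (\<integral>\<^sup>+x. (\<integral>\<^sup>+t. ?c * (ennreal ((t ^ (m - 1)) powr p) * k (z + t ^ m *\<^sub>R (upd x i s - z)))
             * indicator {0..1} t * indicator (cube L) x \<partial>lborel) \<partial>lborel)"
    using pt by (intro nn_integral_mono) (auto simp: indicator_def)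
  \<comment> \<open>Tonelli puts the integral over the cube inside, where \<open>inner\<close>
    applies for each fixed \<open>t\<close>.\<close>
  also have "\<dots> = (\<integral>\<^sup>+t. (\<integral>\<^sup>+x. ?c * (ennreal ((t ^ (m - 1)) powr p) * k (z + t ^ m *\<^sub>R (upd x i s - z)))
             * indicator {0..1} t * indicator (cube L) x \<partial>lborel) \<partial>lborel)"
    by (intro lborel_pair.Fubini') measurable
  also have "\<dots> = (\<integral>\<^sup>+t\<in>{0..1}. ?c * (ennreal ((t ^ (m - 1)) powr p) *
      (\<integral>\<^sup>+x\<in>cube L. k (z + t ^ m *\<^sub>R (upd x i s - z)) \<partial>lborel)) \<partial>lborel)"
  proof (intro nn_integral_cong)
    fix t :: real
    have "(\<integral>\<^sup>+x. ?c * (ennreal ((t ^ (m - 1)) powr p) * k (z + t ^ m *\<^sub>R (upd x i s - z)))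
             * indicator {0..1} t * indicator (cube L) x \<partial>lborel)
       = (\<integral>\<^sup>+x. (?c * ennreal ((t ^ (m - 1)) powr p) * indicator {0..1} t) *
              (k (z + t ^ m *\<^sub>R (upd x i s - z)) * indicator (cube L) x) \<partial>lborel)"
      by (intro nn_integral_cong) (simp add: mult_ac)
    also have "\<dots> = (?c * ennreal ((t ^ (m - 1)) powr p) * indicator {0..1} t) *
        (\<integral>\<^sup>+x\<in>cube L. k (z + t ^ m *\<^sub>R (upd x i s - z)) \<partial>lborel)"
      by (intro nn_integral_cmult) measurable
    finally show "(\<integral>\<^sup>+x. ?c * (ennreal ((t ^ (m - 1)) powr p) * k (z + t ^ m *\<^sub>R (upd x i s - z)))
             * indicator {0..1} t * indicator (cube L) x \<partial>lborel)
        = ?c * (ennreal ((t ^ (m - 1)) powr p) *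
      (\<integral>\<^sup>+x\<in>cube L. k (z + t ^ m *\<^sub>R (upd x i s - z)) \<partial>lborel)) * indicator {0..1} t"
      by (simp add: mult_ac)
  qed
  also have "\<dots> \<le> (\<integral>\<^sup>+(t::real)\<in>{0..1}. ?c * ?R \<partial>lborel)"
    using inner by (intro nn_integral_mono) (auto simp: indicator_def intro: mult_left_mono)
  also have "\<dots> = ?c * ?R"
    by (simp add: nn_integral_cmult)
  finally show ?thesis unfolding k_def D_def .
qed

text \<open>Compares \<open>F x\<close> with its value at the projection of \<open>x\<close> onto
  the slice, along the line in direction \<open>i\<close>. The gradient term integrates over the
  whole line through the cube, so Tonelli turns it into an integral over all slices in direction
  \<open>i\<close>.\<close>

lemma nn_integral_line_le:
  fixes F :: "real ^ 'n \<Rightarrow> real" and G :: "real ^ 'n \<Rightarrow> real ^ 'n"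
  assumes p: "1 < p"
    and F: "\<And>x. (F has_derivative (\<lambda>h. G x \<bullet> h)) (at x)"
    and G: "continuous_on UNIV G"
    and L: "0 \<le> L" and s: "\<bar>s\<bar> \<le> L"
  shows "(\<integral>\<^sup>+x\<in>cube L. ennreal (\<bar>F x\<bar> powr p) \<partial>lborel)
    \<le> ennreal (2 powr p) * ((\<integral>\<^sup>+x\<in>cube L. ennreal (\<bar>F (upd x i s)\<bar> powr p) \<partial>lborel)
       + ennreal ((2 * L) powr (p - 1)) *
         (\<integral>\<^sup>+t\<in>{- L..L}. (\<integral>\<^sup>+x\<in>cube L. ennreal (norm (G (upd x i t)) powr p) \<partial>lborel) \<partial>lborel))"
proof -
  have G_borel [measurable]: "G \<in> borel_measurable borel"
    using G by (rule borel_measurable_continuous_onI)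
  have "continuous_on UNIV F"
    using F by (intro has_derivative_continuous_on) (auto intro: has_derivative_at_withinI)
  then have F_borel [measurable]: "F \<in> borel_measurable borel"
    by (rule borel_measurable_continuous_onI)
  let ?d = "ennreal ((2 * L) powr (p - 1))"
  have pt: "ennreal (\<bar>F x\<bar> powr p) \<le> ennreal (2 powr p) * (ennreal (\<bar>F (upd x i s)\<bar> powr p) +
       ?d * (\<integral>\<^sup>+t\<in>{- L..L}. ennreal (norm (G (upd x i t)) powr p) \<partial>lborel))"
    if x: "x \<in> cube L" for x
  proof -
    have xi: "x $ i \<in> {- L..L}" using x by (auto simp: cube_def abs_le_iff minus_le_iff)
    have der: "((\<lambda>t. F (upd x i t)) has_field_derivative (G (upd x i t) \<bullet> axis i 1)) (at t)" for t
    proof -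
      have "((\<lambda>t. upd x i t) has_derivative (\<lambda>h. h *\<^sub>R axis i 1)) (at t)"
        unfolding upd_eq by (auto intro!: derivative_eq_intros)
      from has_derivative_compose[OF this F]
      show ?thesis
        unfolding has_field_derivative_def by (rule has_derivative_eq_rhs) (auto simp: mult_ac)
    qed
    have "ennreal (\<bar>F (upd x i (x $ i)) - F (upd x i s)\<bar> powr p)
      \<le> ennreal ((L - (- L)) powr (p - 1)) * (\<integral>\<^sup>+t\<in>{- L..L}. ennreal (\<bar>G (upd x i t) \<bullet> axis i 1\<bar> powr p) \<partial>lborel)"
      using xi s der by (intro increment_powr_le[OF p] continuous_intros continuous_on_compose2[OF G]) auto
    also have "\<dots> \<le> ?d * (\<integral>\<^sup>+t\<in>{- L..L}. ennreal (norm (G (upd x i t)) powr p) \<partial>lborel)"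
    proof -
      have "\<bar>G (upd x i t) \<bullet> axis i 1\<bar> \<le> norm (G (upd x i t))" for t
        using Cauchy_Schwarz_ineq2[of "G (upd x i t)" "axis i 1"] by simp
      then show ?thesis using p
        by (auto intro!: mult_mono nn_integral_mono ennreal_leI powr_mono2 mult_right_mono)
    qed
    finally have 1: "ennreal (\<bar>F x - F (upd x i s)\<bar> powr p) \<le> ?d * (\<integral>\<^sup>+t\<in>{- L..L}. ennreal (norm (G (upd x i t)) powr p) \<partial>lborel)"
      by (simp add: upd_triv)
    have "\<bar>F x\<bar> powr p \<le> 2 powr p * (\<bar>F (upd x i s)\<bar> powr p + \<bar>F x - F (upd x i s)\<bar> powr p)"
      using norm_add_powr_le[of p "F (upd x i s)" "F x - F (upd x i s)"] p by simp
    then have "ennreal (\<bar>F x\<bar> powr p) \<le> ennreal (2 powr p) * (ennreal (\<bar>F (upd x i s)\<bar> powr p) + ennreal (\<bar>F x - F (upd x i s)\<bar> powr p))"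
      by (simp add: ennreal_leI flip: ennreal_mult ennreal_plus)
    also have "\<dots> \<le> ennreal (2 powr p) * (ennreal (\<bar>F (upd x i s)\<bar> powr p) + ?d * (\<integral>\<^sup>+t\<in>{- L..L}. ennreal (norm (G (upd x i t)) powr p) \<partial>lborel))"
      using 1 by (intro mult_left_mono add_left_mono) auto
    finally show ?thesis .
  qed
  have "(\<integral>\<^sup>+x\<in>cube L. ennreal (\<bar>F x\<bar> powr p) \<partial>lborel)
     \<le> (\<integral>\<^sup>+x\<in>cube L. ennreal (2 powr p) * (ennreal (\<bar>F (upd x i s)\<bar> powr p) +
       ?d * (\<integral>\<^sup>+t\<in>{- L..L}. ennreal (norm (G (upd x i t)) powr p) \<partial>lborel)) \<partial>lborel)"
    using pt by (intro nn_integral_mono) (auto simp: indicator_def)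
  also have "\<dots> = (\<integral>\<^sup>+x. ennreal (2 powr p) * (ennreal (\<bar>F (upd x i s)\<bar> powr p) * indicator (cube L) x +
       ?d * (\<integral>\<^sup>+t. ennreal (norm (G (upd x i t)) powr p) * indicator {- L..L} t * indicator (cube L) x \<partial>lborel)) \<partial>lborel)"
    by (intro nn_integral_cong) (simp add: indicator_def)
  also have "\<dots> = ennreal (2 powr p) * ((\<integral>\<^sup>+x\<in>cube L. ennreal (\<bar>F (upd x i s)\<bar> powr p) \<partial>lborel) +
       ?d * (\<integral>\<^sup>+x. (\<integral>\<^sup>+t. ennreal (norm (G (upd x i t)) powr p) * indicator {- L..L} t * indicator (cube L) x \<partial>lborel) \<partial>lborel))"
    by (simp add: nn_integral_cmult nn_integral_add)
  also have "(\<integral>\<^sup>+x. (\<integral>\<^sup>+t. ennreal (norm (G (upd x i t)) powr p) * indicator {- L..L} t * indicator (cube L) x \<partial>lborel) \<partial>lborel)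
      = (\<integral>\<^sup>+t. (\<integral>\<^sup>+x. ennreal (norm (G (upd x i t)) powr p) * indicator {- L..L} t * indicator (cube L) x \<partial>lborel) \<partial>lborel)"
    by (intro lborel_pair.Fubini') measurable
  also have "\<dots> = (\<integral>\<^sup>+t\<in>{- L..L}. (\<integral>\<^sup>+x\<in>cube L. ennreal (norm (G (upd x i t)) powr p) \<partial>lborel) \<partial>lborel)"
    by (intro nn_integral_cong) (simp add: indicator_def)
  finally show ?thesis .
qed

text \<open>Turns the distance of a zero from \<open>b\<close> into the offset of one of its
  coordinates, and so into the position of a slice through that zero.\<close>

lemma infnorm_attained: "\<exists>i. infnorm (x :: real ^ 'n) = \<bar>x $ i\<bar>"
proof -
  have "infnorm x \<in> (\<lambda>i. \<bar>x \<bullet> i\<bar>) ` Basis"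
    unfolding infnorm_Max by (intro Max_in) auto
  then show ?thesis by (auto simp: Basis_vec_def cart_eq_inner_axis)
qed

text \<open>For each \<open>r\<close> in \<open>{0..d}\<close> some slice at offset \<open>r\<close>
  or \<open>- r\<close> from \<open>b\<close> contains a zero of \<open>F\<close>. Its direction and
  sign may vary with \<open>r\<close> in an uncontrolled way, so the bound sums over all directions
  and both signs; only then is it integrated over \<open>r\<close>, which produces the factor
  \<open>d\<close> on the left.\<close>

lemma nn_integral_cube_le:
  fixes F :: "real ^ 'n \<Rightarrow> real" and G :: "real ^ 'n \<Rightarrow> real ^ 'n"
  assumes p: "1 < p" and m: "2 \<le> m" "p \<le> real m * (p - (real CARD('n) - 1))"
    and F: "\<And>x. (F has_derivative (\<lambda>h. G x \<bullet> h)) (at x)"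
    and G: "continuous_on UNIV G"
    and L: "0 \<le> L" and d: "0 \<le> d"
    and zeros: "\<And>r. 0 \<le> r \<Longrightarrow> r \<le> d \<Longrightarrow> \<exists>z. z \<in> cube L \<and> F z = 0 \<and> infnorm (z - b) = r"
  shows "ennreal d * (\<integral>\<^sup>+x\<in>cube L. ennreal (\<bar>F x\<bar> powr p) \<partial>lborel)
    \<le> ennreal (2 powr p * (2 * (real m * (2 * L * CARD('n))) powr p + d * (2 * L) powr (p - 1))) *
      (\<Sum>i\<in>UNIV. \<integral>\<^sup>+t\<in>{- L..L}. (\<integral>\<^sup>+x\<in>cube L. ennreal (norm (G (upd x i t)) powr p) \<partial>lborel) \<partial>lborel)"
proof -
  have G_borel [measurable]: "G \<in> borel_measurable borel"
    using G by (rule borel_measurable_continuous_onI)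
  define c where "c = (real m * (2 * L * CARD('n))) powr p"
  define e where "e = (2 * L) powr (p - 1)"
  have ce: "0 \<le> c" "0 \<le> e" by (auto simp: c_def e_def)
  define X where "X = (\<integral>\<^sup>+x\<in>cube L. ennreal (\<bar>F x\<bar> powr p) \<partial>lborel)"
  \<comment> \<open>The cutoff keeps the total integral equal to the slice integral over
    \<open>{- L..L}\<close>, although \<open>b $ i + r\<close> and \<open>b $ i - r\<close> may
    leave that interval.\<close>
  define H where "H = (\<lambda>i t. (\<integral>\<^sup>+x\<in>cube L. ennreal (norm (G (upd x i t)) powr p) \<partial>lborel) * indicator {- L..L} t)"
  define M where "M = (\<lambda>i. \<integral>\<^sup>+t. H i t \<partial>lborel)"
  have H [measurable]: "H i \<in> borel_measurable borel" for i
    unfolding H_def by measurable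
  have shift: "(\<integral>\<^sup>+r. H i (b $ i + r) \<partial>lborel) = M i" "(\<integral>\<^sup>+r. H i (b $ i - r) \<partial>lborel) = M i" for i
    unfolding M_def using nn_integral_real_affine[of "H i" 1 "b $ i"] nn_integral_real_affine[of "H i" "-1" "b $ i"]
    by simp_all
  have pt: "X \<le> (\<Sum>i\<in>UNIV. ennreal (2 powr p) * (ennreal c * (H i (b $ i + r) + H i (b $ i - r)) + ennreal e * M i))"
    (is "_ \<le> (\<Sum>i\<in>UNIV. ?S i)")
    if r: "r \<in> {0..d}" for r
  proof -
    obtain z where z: "z \<in> cube L" "F z = 0" "infnorm (z - b) = r" using zeros[of r] r by auto
    obtain i where i: "r = \<bar>z $ i - b $ i\<bar>" using infnorm_attained[of "z - b"] z by auto
    have zi: "\<bar>z $ i\<bar> \<le> L" using z by (auto simp: cube_def)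
    then have zi': "z $ i \<in> {- L..L}" by auto
    have "X \<le> ennreal (2 powr p) * ((\<integral>\<^sup>+x\<in>cube L. ennreal (\<bar>F (upd x i (z $ i))\<bar> powr p) \<partial>lborel) + ennreal e * M i)"
      unfolding X_def e_def M_def H_def by (rule nn_integral_line_le[OF p F G L zi])
    also have "\<dots> \<le> ennreal (2 powr p) * (ennreal c * H i (z $ i) + ennreal e * M i)"
      unfolding c_def H_def using nn_integral_slice_le[OF p m F G z(1) refl z(2) L, of i] zi'
      by (intro mult_left_mono add_right_mono) auto
    also have "\<dots> \<le> ?S i"
    proof -
      have "z $ i = b $ i + r \<or> z $ i = b $ i - r" using i by auto
      then have "H i (z $ i) \<le> H i (b $ i + r) + H i (b $ i - r)" by auto
      then show ?thesis by (intro mult_left_mono add_right_mono) auto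
    qed
    also have "\<dots> \<le> (\<Sum>i\<in>UNIV. ?S i)" by (intro member_le_sum) auto
    finally show ?thesis .
  qed
  have "ennreal d * X = (\<integral>\<^sup>+r\<in>{0..d}. X \<partial>lborel)"
    using d by (simp add: nn_integral_cmult mult.commute)
  \<comment> \<open>The slice terms lose their restriction to \<open>{0..d}\<close> and integrate to
    \<open>M i\<close> each, hence \<open>2 * c\<close> for the two signs; the constant term keeps
    it and yields \<open>d * e\<close>.\<close>
  also have "\<dots> \<le> (\<integral>\<^sup>+r. (\<Sum>i\<in>UNIV. ennreal (2 powr p) * (ennreal c * (H i (b $ i + r) + H i (b $ i - r))
       + ennreal e * M i * indicator {0..d} r)) \<partial>lborel)"
    using pt by (intro nn_integral_mono) (auto simp: indicator_def)
  also have "\<dots> = (\<Sum>i\<in>UNIV. ennreal (2 powr p) * (ennreal c * (M i + M i) + ennreal e * M i * ennreal d))"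
    using d by (simp add: nn_integral_sum nn_integral_cmult nn_integral_add shift)
  also have "\<dots> = (\<Sum>i\<in>UNIV. ennreal (2 powr p * (2 * c + d * e)) * M i)"
  proof (intro sum.cong refl)
    fix i :: 'n
    have "ennreal (2 powr p * (2 * c + d * e)) = ennreal (2 powr p) * (2 * ennreal c + ennreal d * ennreal e)"
      using ce d by (simp add: ennreal_mult)
    then show "ennreal (2 powr p) * (ennreal c * (M i + M i) + ennreal e * M i * ennreal d) = ennreal (2 powr p * (2 * c + d * e)) * M i"
      by (simp only: mult_2 distrib_left distrib_right mult_ac)
  qed
  finally show ?thesis unfolding X_def M_def H_def c_def e_def by (simp add: sum_distrib_left)
qed

section \<open>From one cube to the whole space\<close>

lemma nn_integral_lborel_shift:
  fixes k :: "'a :: euclidean_space \<Rightarrow> ennreal"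
  assumes [measurable]: "k \<in> borel_measurable borel"
  shows "(\<integral>\<^sup>+a. k (a + c) \<partial>lborel) = (\<integral>\<^sup>+a. k a \<partial>lborel)"
proof -
  have "(\<integral>\<^sup>+a. k a \<partial>lborel) = (\<integral>\<^sup>+a. k a \<partial>distr lborel borel ((+) c))"
    by (simp add: lborel_distr_plus)
  also have "\<dots> = (\<integral>\<^sup>+a. k (c + a) \<partial>lborel)" by (intro nn_integral_distr) auto
  finally show ?thesis by (simp add: add.commute)
qed

text \<open>Averaging over all translates of the cube replaces a tiling of the space.\<close>

lemma nn_integral_poincare:
  fixes f :: "real ^ 'n \<Rightarrow> real" and g :: "real ^ 'n \<Rightarrow> real ^ 'n"
  assumes p: "1 < p" and m: "2 \<le> m" "p \<le> real m * (p - (real CARD('n) - 1))"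
    and f: "\<And>x. (f has_derivative (\<lambda>h. g x \<bullet> h)) (at x)"
    and g: "continuous_on UNIV g"
    and L: "0 < L" and d: "0 \<le> d"
    and zeros: "\<And>a. \<exists>b. \<forall>r. 0 \<le> r \<longrightarrow> r \<le> d \<longrightarrow> (\<exists>z. z - a \<in> cube L \<and> f z = 0 \<and> infnorm (z - b) = r)"
  shows "ennreal d * (\<integral>\<^sup>+x. ennreal (\<bar>f x\<bar> powr p) \<partial>lborel)
    \<le> ennreal (2 powr p * (2 * (real m * (2 * L * CARD('n))) powr p + d * (2 * L) powr (p - 1)) * CARD('n) * (2 * L)) *
      (\<integral>\<^sup>+x. ennreal (norm (g x) powr p) \<partial>lborel)"
proof -
  have g_borel [measurable]: "g \<in> borel_measurable borel"
    using g by (rule borel_measurable_continuous_onI)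
  have "continuous_on UNIV f"
    using f by (intro has_derivative_continuous_on) (auto intro: has_derivative_at_withinI)
  then have f_borel [measurable]: "f \<in> borel_measurable borel"
    by (rule borel_measurable_continuous_onI)
  define K where "K = 2 powr p * (2 * (real m * (2 * L * CARD('n))) powr p + d * (2 * L) powr (p - 1))"
  have K: "0 \<le> K" using d by (auto simp: K_def)
  define k where "k = (\<lambda>x. ennreal (norm (g x) powr p))"
  define h where "h = (\<lambda>x. ennreal (\<bar>f x\<bar> powr p))"
  have [measurable]: "k \<in> borel_measurable borel" "h \<in> borel_measurable borel"
    unfolding k_def h_def by measurable
  let ?Q = "cube L :: (real ^ 'n) set"
  define V where "V = (2 * L) ^ CARD('n)"
  have V: "emeasure lborel ?Q = ennreal V" "V > 0" using L by (auto simp: emeasure_cube V_def)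
  \<comment> \<open>The cube estimate for the translate of \<open>f\<close> by \<open>a\<close>. The
    centre \<open>b\<close> depends on \<open>a\<close>, the constant does not.\<close>
  have pt: "ennreal d * (\<integral>\<^sup>+x\<in>?Q. h (a + x) \<partial>lborel)
      \<le> ennreal K * (\<Sum>i\<in>UNIV. \<integral>\<^sup>+t\<in>{- L..L}. (\<integral>\<^sup>+x\<in>?Q. k (a + upd x i t) \<partial>lborel) \<partial>lborel)" for a
  proof -
    obtain b where b: "\<And>r. 0 \<le> r \<Longrightarrow> r \<le> d \<Longrightarrow> \<exists>z. z - a \<in> ?Q \<and> f z = 0 \<and> infnorm (z - b) = r"
      using zeros[of a] by blast
    have "((\<lambda>x. f (a + x)) has_derivative (\<lambda>h. g (a + x) \<bullet> h)) (at x)" for x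
    proof -
      have "((\<lambda>x. a + x) has_derivative (\<lambda>h. h)) (at x)" by (auto intro!: derivative_eq_intros)
      from has_derivative_compose[OF this f] show ?thesis .
    qed
    moreover have "continuous_on UNIV (\<lambda>x. g (a + x))"
      by (intro continuous_on_compose2[OF g] continuous_intros) auto
    moreover have "\<exists>z. z \<in> ?Q \<and> f (a + z) = 0 \<and> infnorm (z - (b - a)) = r" if "0 \<le> r" "r \<le> d" for r
    proof -
      obtain z where "z - a \<in> ?Q" "f z = 0" "infnorm (z - b) = r" using b[OF \<open>0 \<le> r\<close> \<open>r \<le> d\<close>] by blast
      then show ?thesis by (intro exI[of _ "z - a"]) simp
    qed
    ultimately show ?thesis unfolding h_def k_def K_def
      by (intro nn_integral_cube_le[OF p m]) (use L d in auto)
  qed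
  \<comment> \<open>For each fixed \<open>x\<close>, integration over all \<open>a\<close> gives the
    full integral of \<open>h\<close>; the cube contributes its volume \<open>V\<close>.\<close>
  have avg_h: "(\<integral>\<^sup>+a. (\<integral>\<^sup>+x\<in>?Q. h (a + x) \<partial>lborel) \<partial>lborel) = ennreal V * (\<integral>\<^sup>+a. h a \<partial>lborel)"
  proof -
    have "(\<integral>\<^sup>+a. (\<integral>\<^sup>+x\<in>?Q. h (a + x) \<partial>lborel) \<partial>lborel) = (\<integral>\<^sup>+x. (\<integral>\<^sup>+a. h (a + x) * indicator ?Q x \<partial>lborel) \<partial>lborel)"
      by (intro lborel_pair.Fubini') measurable
    also have "\<dots> = (\<integral>\<^sup>+x. (\<integral>\<^sup>+a. h a \<partial>lborel) * indicator ?Q x \<partial>lborel)"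
      by (simp add: nn_integral_multc nn_integral_lborel_shift)
    also have "\<dots> = ennreal V * (\<integral>\<^sup>+a. h a \<partial>lborel)"
      by (simp add: nn_integral_cmult V mult.commute)
    finally show ?thesis .
  qed
  \<comment> \<open>Translation by \<open>upd x i t\<close> is absorbed in the same way, so every
    slice gives the same value and the range of \<open>t\<close> contributes
    \<open>2 * L\<close>.\<close>
  have avg_k: "(\<integral>\<^sup>+a. (\<integral>\<^sup>+t\<in>{- L..L}. (\<integral>\<^sup>+x\<in>?Q. k (a + upd x i t) \<partial>lborel) \<partial>lborel) \<partial>lborel)
      = ennreal (2 * L) * (ennreal V * (\<integral>\<^sup>+a. k a \<partial>lborel))" for i
  proof -
    have "(\<integral>\<^sup>+a. (\<integral>\<^sup>+t\<in>{- L..L}. (\<integral>\<^sup>+x\<in>?Q. k (a + upd x i t) \<partial>lborel) \<partial>lborel) \<partial>lborel)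
       = (\<integral>\<^sup>+t. (\<integral>\<^sup>+a. (\<integral>\<^sup>+x\<in>?Q. k (a + upd x i t) \<partial>lborel) * indicator {- L..L} t \<partial>lborel) \<partial>lborel)"
      by (intro lborel_pair.Fubini') measurable
    also have "\<dots> = (\<integral>\<^sup>+t. (\<integral>\<^sup>+a. (\<integral>\<^sup>+x\<in>?Q. k (a + upd x i t) \<partial>lborel) \<partial>lborel) * indicator {- L..L} t \<partial>lborel)"
      by (simp add: nn_integral_multc)
    also have "\<dots> = (\<integral>\<^sup>+t. (ennreal V * (\<integral>\<^sup>+a. k a \<partial>lborel)) * indicator {- L..L} t \<partial>lborel)"
    proof -
      have "(\<integral>\<^sup>+a. (\<integral>\<^sup>+x\<in>?Q. k (a + upd x i t) \<partial>lborel) \<partial>lborel) = ennreal V * (\<integral>\<^sup>+a. k a \<partial>lborel)" for t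
      proof -
        have "(\<integral>\<^sup>+a. (\<integral>\<^sup>+x\<in>?Q. k (a + upd x i t) \<partial>lborel) \<partial>lborel) = (\<integral>\<^sup>+x. (\<integral>\<^sup>+a. k (a + upd x i t) * indicator ?Q x \<partial>lborel) \<partial>lborel)"
          by (intro lborel_pair.Fubini') measurable
        also have "\<dots> = (\<integral>\<^sup>+x. (\<integral>\<^sup>+a. k a \<partial>lborel) * indicator ?Q x \<partial>lborel)"
          by (simp add: nn_integral_multc nn_integral_lborel_shift)
        also have "\<dots> = ennreal V * (\<integral>\<^sup>+a. k a \<partial>lborel)"
          by (simp add: nn_integral_cmult V mult.commute)
        finally show ?thesis .
      qed
      then show ?thesis by simp
    qed
    also have "\<dots> = ennreal (2 * L) * (ennreal V * (\<integral>\<^sup>+a. k a \<partial>lborel))"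
      using L by (simp add: nn_integral_cmult mult_ac)
    finally show ?thesis .
  qed
  have "ennreal V * (ennreal d * (\<integral>\<^sup>+x. h x \<partial>lborel)) = ennreal d * (ennreal V * (\<integral>\<^sup>+x. h x \<partial>lborel))"
    by (rule mult.left_commute)
  also have "\<dots> = (\<integral>\<^sup>+a. ennreal d * (\<integral>\<^sup>+x\<in>?Q. h (a + x) \<partial>lborel) \<partial>lborel)"
    by (subst nn_integral_cmult) (simp_all add: avg_h)
  also have "\<dots> \<le> (\<integral>\<^sup>+a. ennreal K * (\<Sum>i\<in>UNIV. \<integral>\<^sup>+t\<in>{- L..L}. (\<integral>\<^sup>+x\<in>?Q. k (a + upd x i t) \<partial>lborel) \<partial>lborel) \<partial>lborel)"
    by (intro nn_integral_mono pt)
  also have "\<dots> = ennreal K * (\<Sum>i\<in>(UNIV :: 'n set). ennreal (2 * L) * (ennreal V * (\<integral>\<^sup>+a. k a \<partial>lborel)))"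
    by (subst nn_integral_cmult, measurable) (subst nn_integral_sum, auto simp: avg_k)
  also have "\<dots> = ennreal V * (ennreal (K * CARD('n) * (2 * L)) * (\<integral>\<^sup>+a. k a \<partial>lborel))"
    using K L by (simp add: ennreal_mult ennreal_of_nat_eq_real_of_nat mult_ac)
  finally have le: "ennreal V * (ennreal d * (\<integral>\<^sup>+x. h x \<partial>lborel)) \<le> ennreal V * (ennreal (K * CARD('n) * (2 * L)) * (\<integral>\<^sup>+a. k a \<partial>lborel))" .
  \<comment> \<open>\<open>V\<close> is positive and finite, so it cancels also when the integrals
    are infinite.\<close>
  have inv: "ennreal (1 / V) * (ennreal V * y) = y" for y
    using V by (simp flip: mult.assoc ennreal_mult)
  from mult_left_mono[OF le, of "ennreal (1 / V)"] show ?thesis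
    unfolding inv K_def h_def k_def by simp
qed

section \<open>The inradius and the frontier\<close>

text \<open>The set of admissible radii is nonempty because the domain is open and nonempty, and
  bounded above because the domain is bounded, so \<open>Sup\<close> is a genuine supremum.\<close>

lemma inradius_bounds:
  fixes \<Omega> :: "(real ^ 'n) set"
  assumes "domain \<Omega>" "bounded \<Omega>"
  shows ball_radius_le_inradius: "0 < r \<Longrightarrow> ball x r \<subseteq> \<Omega> \<Longrightarrow> r \<le> inradius \<Omega>"
    and inradius_pos: "0 < inradius \<Omega>"
    and ball_radius_gt: "s < inradius \<Omega> \<Longrightarrow> \<exists>r>s. \<exists>x. ball x r \<subseteq> \<Omega>"
proof -
  let ?S = "{r. 0 < r \<and> (\<exists>x. ball x r \<subseteq> \<Omega>)}"
  obtain B where B: "\<Omega> \<subseteq> ball 0 B"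
    using assms(2) bounded_subset_ballD by blast
  have bdd: "bdd_above ?S"
  proof (rule bdd_aboveI[of _ B])
    fix r assume "r \<in> ?S"
    then obtain x where "0 < r" "ball x r \<subseteq> \<Omega>" by auto
    with B have "ball x r \<subseteq> ball 0 B" by auto
    with \<open>0 < r\<close> show "r \<le> B"
      by (metis ball_subset_ball_iff add.commute le_add_same_cancel2 linorder_not_less norm_ge_zero order_trans zero_le_dist)
  qed
  show le: "0 < r \<Longrightarrow> ball x r \<subseteq> \<Omega> \<Longrightarrow> r \<le> inradius \<Omega>" for r x
    unfolding inradius_def using bdd by (intro cSup_upper) auto
  obtain y where "y \<in> \<Omega>" using assms by (auto simp: domain_def)
  then obtain r where r: "0 < r" "ball y r \<subseteq> \<Omega>"
    using assms(1) unfolding domain_def by (meson open_contains_ball)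
  then show "0 < inradius \<Omega>" using le[of r y] by simp
  show "\<exists>r>s. \<exists>x. ball x r \<subseteq> \<Omega>" if "s < inradius \<Omega>"
    using that r bdd unfolding inradius_def by (subst (asm) less_cSup_iff) auto
qed

text \<open>The ray is connected, starts inside and leaves the bounded set, so it meets the
  frontier. An open set is disjoint from its frontier, hence the meeting point lies outside the
  ball.\<close>

lemma ray_meets_frontier:
  fixes \<Omega> :: "'a :: euclidean_space set"
  assumes "open \<Omega>" "bounded \<Omega>" "0 < r" "ball c r \<subseteq> \<Omega>" "norm e = 1"
  shows "\<exists>t\<ge>r. c + t *\<^sub>R e \<in> frontier \<Omega>"
proof -
  obtain B where B: "\<And>x. x \<in> \<Omega> \<Longrightarrow> norm x \<le> B"
    using assms(2) by (auto simp: bounded_iff)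
  let ?S = "(\<lambda>t. c + t *\<^sub>R e) ` {0..}"
  have "c \<in> \<Omega>" using assms by auto
  then have "c + 0 *\<^sub>R e \<in> ?S \<inter> \<Omega>" by (intro IntI imageI) auto
  moreover have "c + (norm c + B + 1) *\<^sub>R e \<in> ?S - \<Omega>"
  proof -
    have B0: "0 \<le> B" using B[OF \<open>c \<in> \<Omega>\<close>] norm_ge_zero order_trans by blast
    have "norm ((norm c + B + 1) *\<^sub>R e) \<le> norm (c + (norm c + B + 1) *\<^sub>R e) + norm c"
      using norm_triangle_ineq4[of "c + (norm c + B + 1) *\<^sub>R e" c] by simp
    then have "B < norm (c + (norm c + B + 1) *\<^sub>R e)" using assms(5) B0 by simp
    then show ?thesis using B[of "c + (norm c + B + 1) *\<^sub>R e"] B0 by (auto intro!: imageI)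
  qed
  moreover have "connected ?S"
    by (intro connected_continuous_image continuous_intros) auto
  ultimately have "?S \<inter> frontier \<Omega> \<noteq> {}" by (intro connected_Int_frontier) blast+
  then obtain t where t: "0 \<le> t" "c + t *\<^sub>R e \<in> frontier \<Omega>" by auto
  have "c + t *\<^sub>R e \<notin> \<Omega>" using t assms by (auto simp: frontier_def interior_open)
  then have "c + t *\<^sub>R e \<notin> ball c r" using assms by auto
  then have "r \<le> t" using t assms by (auto simp: dist_norm)
  then show ?thesis using t by blast
qed

text \<open>For \<open>b\<close> on the frontier, \<open>infnorm (z - b)\<close> takes all intermediate values as \<open>z\<close> ranges over
  the connected frontier.\<close>

lemma exists_outer_spheres:
  fixes \<Omega> :: "(real ^ 'n) set"
  assumes dom: "domain \<Omega>" "bounded \<Omega>" and conn: "connected (frontier \<Omega>)"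
  defines "\<rho> \<equiv> inradius \<Omega>"
  shows "\<exists>b. \<forall>r. 0 \<le> r \<longrightarrow> r \<le> \<rho> / 2 \<longrightarrow> (\<exists>z. z - a \<in> cube (3 * \<rho>) \<and> z \<notin> \<Omega> \<and> infnorm (z - b) = r)"
proof -
  have rho: "0 < \<rho>" unfolding \<rho>_def using dom by (rule inradius_pos)
  have op: "open \<Omega>" using dom by (simp add: domain_def)
  have nsub: "\<not> ball a (2 * \<rho>) \<subseteq> \<Omega>"
    using ball_radius_le_inradius[OF dom, of "2 * \<rho>" a] rho by (auto simp: \<rho>_def)
  \<comment> \<open>This fixes the half-width of the cube:
    \<open>2 * \<rho> + \<rho> / 2 \<le> 3 * \<rho>\<close>.\<close>
  have cubeI: "z - a \<in> cube (3 * \<rho>)" if "dist a b < 2 * \<rho>" "infnorm (z - b) \<le> \<rho> / 2" for z b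
  proof -
    have "\<bar>(z - a) $ j\<bar> \<le> 3 * \<rho>" for j
    proof -
      have "\<bar>(z - b) $ j\<bar> \<le> infnorm (z - b)" by (rule component_le_infnorm_cart)
      moreover have "\<bar>(a - b) $ j\<bar> \<le> dist a b" unfolding dist_norm by (rule component_le_norm_cart)
      ultimately show ?thesis using that rho by simp
    qed
    then show ?thesis by (simp add: cube_def)
  qed
  show ?thesis
  proof (cases "ball a (2 * \<rho>) \<inter> \<Omega> = {}")
    \<comment> \<open>All of \<open>ball a (2 * \<rho>)\<close> lies outside the domain, so points
      at distance \<open>r\<close> from \<open>a\<close> along an arbitrary axis serve, with
      \<open>b = a\<close>.\<close>
    case True
    show ?thesis
    proof (rule exI[of _ a], intro allI impI)
      fix r assume r: "0 \<le> r" "r \<le> \<rho> / 2"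
      define z where "z = a + r *\<^sub>R axis (undefined :: 'n) (1::real)"
      have n: "norm (z - a) = r" using r by (simp add: z_def)
      have "infnorm (z - a) = r"
      proof (rule antisym)
        show "infnorm (z - a) \<le> r" using infnorm_le_norm[of "z - a"] n by simp
        show "r \<le> infnorm (z - a)"
          using component_le_infnorm_cart[of "z - a" undefined] r by (simp add: z_def)
      qed
      moreover have "z \<notin> \<Omega>"
      proof -
        have "z \<in> ball a (2 * \<rho>)" using n r rho by (simp add: dist_norm norm_minus_commute)
        with True show ?thesis by blast
      qed
      ultimately show "\<exists>z. z - a \<in> cube (3 * \<rho>) \<and> z \<notin> \<Omega> \<and> infnorm (z - a) = r"
        using cubeI[of a z] r rho by auto
    qed
  next
    case False
    with nsub have "ball a (2 * \<rho>) \<inter> frontier \<Omega> \<noteq> {}"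
      by (intro connected_Int_frontier) auto
    then obtain b where b: "dist a b < 2 * \<rho>" "b \<in> frontier \<Omega>" by auto
    obtain r0 c where r0: "\<rho> / 2 < r0" "ball c r0 \<subseteq> \<Omega>"
      using ball_radius_gt[OF dom, of "\<rho> / 2"] rho by (auto simp: \<rho>_def)
    \<comment> \<open>Opposite rays from \<open>c\<close> hit the frontier at points whose
      coordinates \<open>i\<close> differ by at least \<open>2 * r0 > \<rho>\<close>, so one of them
      is at least \<open>\<rho> / 2\<close> away from \<open>b $ i\<close>.\<close>
    have "\<exists>y\<in>frontier \<Omega>. \<rho> / 2 \<le> infnorm (y - b)"
    proof -
      define i :: 'n where "i = undefined"
      obtain t where t: "t \<ge> r0" "c + t *\<^sub>R axis i 1 \<in> frontier \<Omega>"
        using ray_meets_frontier[OF op dom(2) _ r0(2), of "axis i 1"] r0 rho by auto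
      obtain u where u: "u \<ge> r0" "c + u *\<^sub>R (- axis i 1) \<in> frontier \<Omega>"
        using ray_meets_frontier[OF op dom(2) _ r0(2), of "- axis i 1"] r0 rho by auto
      have "\<bar>c $ i + t - b $ i\<bar> \<le> infnorm (c + t *\<^sub>R axis i 1 - b)"
        using component_le_infnorm_cart[of "c + t *\<^sub>R axis i 1 - b" i] by simp
      moreover have "\<bar>c $ i - u - b $ i\<bar> \<le> infnorm (c + u *\<^sub>R (- axis i 1) - b)"
        using component_le_infnorm_cart[of "c + u *\<^sub>R (- axis i 1) - b" i] by simp
      moreover have "\<rho> / 2 \<le> \<bar>c $ i + t - b $ i\<bar> \<or> \<rho> / 2 \<le> \<bar>c $ i - u - b $ i\<bar>"
        using t(1) u(1) r0(1) by linarith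
      ultimately show ?thesis using t(2) u(2) by force
    qed
    then obtain y where y: "y \<in> frontier \<Omega>" "\<rho> / 2 \<le> infnorm (y - b)" by blast
    \<comment> \<open>A connected set of reals containing \<open>0\<close> and a value of at least
      \<open>\<rho> / 2\<close> contains everything between them.\<close>
    have img: "connected ((\<lambda>z. infnorm (z - b)) ` frontier \<Omega>)"
      by (intro connected_continuous_image continuous_intros conn)
    show ?thesis
    proof (rule exI[of _ b], intro allI impI)
      fix r assume r: "0 \<le> r" "r \<le> \<rho> / 2"
      have "infnorm (b - b) \<in> (\<lambda>z. infnorm (z - b)) ` frontier \<Omega>" using b by (intro imageI)
      moreover have "infnorm (y - b) \<in> (\<lambda>z. infnorm (z - b)) ` frontier \<Omega>" using y by (intro imageI)
      ultimately have "{infnorm (b - b)..infnorm (y - b)} \<subseteq> (\<lambda>z. infnorm (z - b)) ` frontier \<Omega>"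
        using img by (intro connected_contains_Icc)
      then have "r \<in> (\<lambda>z. infnorm (z - b)) ` frontier \<Omega>" using r y by (auto simp: infnorm_0)
      then obtain z where z: "z \<in> frontier \<Omega>" "infnorm (z - b) = r" by auto
      then have "z \<notin> \<Omega>" using op by (auto simp: frontier_def interior_open)
      then show "\<exists>z. z - a \<in> cube (3 * \<rho>) \<and> z \<notin> \<Omega> \<and> infnorm (z - b) = r"
        using z cubeI[OF b(1), of z] r by auto
    qed
  qed
qed

section \<open>Test functions\<close>

lemma test_function_zero: "test_function \<Omega> \<phi> \<Longrightarrow> x \<notin> \<Omega> \<Longrightarrow> \<phi> x = 0"
  using closure_subset[of "{x. \<phi> x \<noteq> 0}"] by (auto simp: test_function_def)

lemma test_function_has_derivative:
  assumes "test_function \<Omega> \<phi>"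
  shows "(\<phi> has_derivative (\<lambda>h. grad \<phi> x \<bullet> h)) (at x)"
proof -
  have "C_k 1 \<phi>" using assms by (simp add: test_function_def)
  then have "\<phi> differentiable (at x)" by simp
  then have d: "(\<phi> has_derivative frechet_derivative \<phi> (at x)) (at x)"
    by (simp add: frechet_derivative_works)
  then have lin: "linear (frechet_derivative \<phi> (at x))" by (rule has_derivative_linear)
  have "frechet_derivative \<phi> (at x) h = grad \<phi> x \<bullet> h" for h
  proof -
    have "frechet_derivative \<phi> (at x) h = frechet_derivative \<phi> (at x) (\<Sum>i\<in>UNIV. h $ i *s axis i 1)"
      by (simp only: basis_expansion)
    also have "\<dots> = (\<Sum>i\<in>UNIV. h $ i * frechet_derivative \<phi> (at x) (axis i 1))"
      by (simp add: linear_sum[OF lin] linear_cmul[OF lin] scalar_mult_eq_scaleR)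
    also have "\<dots> = grad \<phi> x \<bullet> h"
      by (simp add: grad_def inner_vec_def mult.commute)
    finally show ?thesis .
  qed
  then have "frechet_derivative \<phi> (at x) = (\<lambda>h. grad \<phi> x \<bullet> h)" by blast
  with d show ?thesis by simp
qed

lemma test_function_continuous_grad:
  assumes "test_function \<Omega> \<phi>"
  shows "continuous_on UNIV (grad \<phi>)"
proof -
  have "C_k (Suc 0) \<phi>" using assms by (simp add: test_function_def)
  then show ?thesis unfolding grad_def by (auto intro!: continuous_on_vec_lambda)
qed

text \<open>The choices \<open>L = 3 * \<rho>\<close> and \<open>d = \<rho> / 2\<close> are
  proportional to the inradius, so by homogeneity all of its powers combine into
  \<open>\<rho> powr p\<close> and \<open>K\<close> depends only on N and \<open>p\<close>.\<close>

lemma poincare_inradius: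
  fixes p :: real
  assumes p: "1 < p" "p > real CARD('n) - 1"
  shows "\<exists>K>0. \<forall>(\<Omega> :: (real ^ 'n) set) \<phi>. domain \<Omega> \<and> bounded \<Omega> \<and> connected (frontier \<Omega>) \<and> test_function \<Omega> \<phi> \<longrightarrow>
    (\<integral>\<^sup>+x. ennreal (\<bar>\<phi> x\<bar> powr p) \<partial>lborel)
      \<le> ennreal (K * inradius \<Omega> powr p) * (\<integral>\<^sup>+x. ennreal (norm (grad \<phi> x) powr p) \<partial>lborel)"
proof -
  \<comment> \<open>This is where \<open>p > N - 1\<close> enters: it makes the factor of
    \<open>m0\<close> positive.\<close>
  obtain m0 :: nat where m0: "p < real m0 * (p - (real CARD('n) - 1))"
    using ex_less_of_nat_mult[of "p - (real CARD('n) - 1)" p] p by auto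
  define m where "m = max 2 m0"
  have "real m0 * (p - (real CARD('n) - 1)) \<le> real m * (p - (real CARD('n) - 1))"
    using p by (intro mult_right_mono) (auto simp: m_def)
  then have m: "2 \<le> m" "p \<le> real m * (p - (real CARD('n) - 1))" using m0 by (auto simp: m_def)
  let ?N = "real CARD('n)"
  \<comment> \<open>The constant of \<open>nn_integral_poincare\<close> for these \<open>L\<close>
    and \<open>d\<close>, divided by \<open>d * \<rho> powr p\<close>; the last factor is
    \<open>2 * L / d = 12\<close>.\<close>
  define K where "K = 2 powr p * (2 * (real m * (6 * ?N)) powr p + 6 powr (p - 1) / 2) * ?N * 12"
  have K: "0 < K" unfolding K_def using m by (intro mult_pos_pos add_nonneg_pos) auto
  show ?thesis
  proof (intro exI[of _ K] conjI K allI impI, elim conjE)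
    fix \<Omega> :: "(real ^ 'n) set" and \<phi>
    assume \<Omega>: "domain \<Omega>" "bounded \<Omega>" "connected (frontier \<Omega>)" and \<phi>: "test_function \<Omega> \<phi>"
    define \<rho> where "\<rho> = inradius \<Omega>"
    have rho: "0 < \<rho>" unfolding \<rho>_def using \<Omega> by (intro inradius_pos)
    let ?A = "\<integral>\<^sup>+x. ennreal (\<bar>\<phi> x\<bar> powr p) \<partial>lborel"
    let ?B = "\<integral>\<^sup>+x. ennreal (norm (grad \<phi> x) powr p) \<partial>lborel"
    have "ennreal (\<rho> / 2) * ?A
      \<le> ennreal (2 powr p * (2 * (real m * (2 * (3 * \<rho>) * CARD('n))) powr p + \<rho> / 2 * (2 * (3 * \<rho>)) powr (p - 1)) * CARD('n) * (2 * (3 * \<rho>))) * ?B"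
    proof (rule nn_integral_poincare[OF p(1) m test_function_has_derivative[OF \<phi>] test_function_continuous_grad[OF \<phi>]])
      fix a
      obtain b where b: "\<And>r. 0 \<le> r \<Longrightarrow> r \<le> \<rho> / 2 \<Longrightarrow> \<exists>z. z - a \<in> cube (3 * \<rho>) \<and> z \<notin> \<Omega> \<and> infnorm (z - b) = r"
        using exists_outer_spheres[OF \<Omega>, of a] unfolding \<rho>_def by blast
      show "\<exists>b. \<forall>r\<ge>0. r \<le> \<rho> / 2 \<longrightarrow> (\<exists>z. z - a \<in> cube (3 * \<rho>) \<and> \<phi> z = 0 \<and> infnorm (z - b) = r)"
        using b test_function_zero[OF \<phi>] by (intro exI[of _ b]) blast
    qed (use rho in auto)
    also have "2 powr p * (2 * (real m * (2 * (3 * \<rho>) * ?N)) powr p + \<rho> / 2 * (2 * (3 * \<rho>)) powr (p - 1)) * ?N * (2 * (3 * \<rho>))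
       = (K * \<rho> powr p) * (\<rho> / 2)"
    proof -
      have "(real m * (2 * (3 * \<rho>) * ?N)) powr p = (real m * (6 * ?N)) powr p * \<rho> powr p"
        using rho by (simp add: powr_mult mult_ac)
      moreover have "\<rho> / 2 * (2 * (3 * \<rho>)) powr (p - 1) = 6 powr (p - 1) / 2 * \<rho> powr p"
        using rho by (simp add: powr_mult powr_diff)
      ultimately show ?thesis by (simp add: K_def algebra_simps)
    qed
    finally have le: "ennreal (\<rho> / 2) * ?A \<le> ennreal ((K * \<rho> powr p) * (\<rho> / 2)) * ?B" .
    have "ennreal (2 / \<rho>) * (ennreal (\<rho> / 2) * ?A) \<le> ennreal (2 / \<rho>) * (ennreal ((K * \<rho> powr p) * (\<rho> / 2)) * ?B)"
      using le by (intro mult_left_mono) auto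
    then show "?A \<le> ennreal (K * inradius \<Omega> powr p) * ?B"
      using rho K by (simp add: \<rho>_def flip: mult.assoc ennreal_mult)
  qed
qed

section \<open>Support and integrability of test functions\<close>

lemma grad_test_function_zero:
  assumes "test_function \<Omega> \<phi>" and x: "x \<notin> closure {x. \<phi> x \<noteq> 0}"
  shows "grad \<phi> x = 0"
proof -
  have "((\<lambda>_. 0) has_derivative (\<lambda>h. grad \<phi> x \<bullet> h)) (at x)"
  proof (rule has_derivative_transform_within_open[OF test_function_has_derivative[OF assms(1)]])
    show "open (- closure {x. \<phi> x \<noteq> 0})" by auto
    show "x \<in> - closure {x. \<phi> x \<noteq> 0}" using x by simp
    show "\<phi> y = 0" if "y \<in> - closure {x. \<phi> x \<noteq> 0}" for y
      using that closure_subset[of "{x. \<phi> x \<noteq> 0}"] by auto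
  qed
  then have "(\<lambda>h. grad \<phi> x \<bullet> h) = (\<lambda>h. 0)"
    using has_derivative_unique has_derivative_const by blast
  then have "grad \<phi> x \<bullet> grad \<phi> x = 0" by metis
  then show ?thesis by simp
qed

lemma integrable_powr_compact_support:
  fixes f :: "'a :: euclidean_space \<Rightarrow> 'b :: real_normed_vector"
  assumes p: "0 < p" and f: "continuous_on UNIV f" and S: "compact S" "\<And>x. x \<notin> S \<Longrightarrow> f x = 0"
  shows "integrable lborel (\<lambda>x. norm (f x) powr p)"
proof -
  have "integrable lborel (\<lambda>x. indicator S x *\<^sub>R (norm (f x) powr p))"
    using p continuous_on_subset[OF f]
    by (intro borel_integrable_compact S continuous_on_powr' continuous_intros) auto
  moreover have "indicator S x *\<^sub>R (norm (f x) powr p) = norm (f x) powr p" for x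
    using S(2)[of x] by (auto simp: indicator_def)
  ultimately show ?thesis by (simp only:)
qed

lemma test_function_continuous:
  assumes "test_function \<Omega> \<phi>"
  shows "continuous_on UNIV \<phi>"
  using test_function_has_derivative[OF assms]
  by (intro has_derivative_continuous_on) (auto intro: has_derivative_at_withinI)

lemma test_function_integrable:
  assumes p: "0 < p" and \<phi>: "test_function \<Omega> \<phi>"
  shows "integrable lborel (\<lambda>x. \<bar>\<phi> x\<bar> powr p)" "integrable lborel (\<lambda>x. norm (grad \<phi> x) powr p)"
proof -
  let ?S = "closure {x. \<phi> x \<noteq> 0}"
  have S: "compact ?S" using \<phi> by (simp add: test_function_def)
  show "integrable lborel (\<lambda>x. norm (grad \<phi> x) powr p)"
    using test_function_continuous_grad[OF \<phi>] grad_test_function_zero[OF \<phi>]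
    by (intro integrable_powr_compact_support[OF p _ S]) auto
  have "integrable lborel (\<lambda>x. norm (\<phi> x) powr p)"
    using test_function_continuous[OF \<phi>] closure_subset[of "{x. \<phi> x \<noteq> 0}"]
    by (intro integrable_powr_compact_support[OF p _ S]) auto
  then show "integrable lborel (\<lambda>x. \<bar>\<phi> x\<bar> powr p)" by simp
qed

lemma grad_eq_0_outside: "test_function \<Omega> \<phi> \<Longrightarrow> x \<notin> \<Omega> \<Longrightarrow> grad \<phi> x = 0"
  by (rule grad_test_function_zero) (auto simp: test_function_def)

text \<open>Connects the two settings: the Poincare inequality is proved with \<open>lborel\<close>
  on the whole space, while eigenvalues are defined with Lebesgue measure on the domain. Nothing is
  lost since a test function and its gradient vanish outside.\<close>

lemma test_function_restrict:
  fixes \<Omega> :: "(real ^ 'n) set"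
  assumes p: "0 < p" and \<phi>: "test_function \<Omega> \<phi>" and op: "open \<Omega>"
  defines "M \<equiv> restrict_space lebesgue \<Omega>"
  shows "\<phi> \<in> borel_measurable M" "grad \<phi> \<in> borel_measurable M"
    "integrable M (\<lambda>x. \<bar>\<phi> x\<bar> powr p)" "integrable M (\<lambda>x. norm (grad \<phi> x) powr p)"
    "(LINT x|M. \<bar>\<phi> x\<bar> powr p) = (LINT x|lborel. \<bar>\<phi> x\<bar> powr p)"
    "(LINT x|M. norm (grad \<phi> x) powr p) = (LINT x|lborel. norm (grad \<phi> x) powr p)"
proof -
  have \<Omega>: "\<Omega> \<inter> space lebesgue \<in> sets lebesgue" using op by auto
  have meas: "f \<in> borel_measurable M" if "continuous_on UNIV f" for f :: "real ^ 'n \<Rightarrow> 'b :: euclidean_space"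
    unfolding M_def using borel_measurable_continuous_onI[OF that]
    by (intro measurable_restrict_space1 measurable_completion) simp
  show "\<phi> \<in> borel_measurable M" "grad \<phi> \<in> borel_measurable M"
    using meas test_function_continuous[OF \<phi>] test_function_continuous_grad[OF \<phi>] by auto
  have *: "integrable M f \<and> (LINT x|M. f x) = (LINT x|lborel. f x)"
    if f: "integrable lborel f" "\<And>x. x \<notin> \<Omega> \<Longrightarrow> f x = 0" for f :: "real ^ 'n \<Rightarrow> real"
  proof -
    have eq: "indicator \<Omega> x *\<^sub>R f x = f x" for x using f(2)[of x] by (auto simp: indicator_def)
    have fm: "f \<in> borel_measurable lborel" using f by auto
    show ?thesis
      unfolding M_def integrable_restrict_space[OF \<Omega>] integral_restrict_space[OF \<Omega>] eq
      using f(1) fm by (simp add: integrable_completion integral_completion)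
  qed
  show "integrable M (\<lambda>x. \<bar>\<phi> x\<bar> powr p)" "(LINT x|M. \<bar>\<phi> x\<bar> powr p) = (LINT x|lborel. \<bar>\<phi> x\<bar> powr p)"
    using *[OF test_function_integrable(1)[OF p \<phi>]] test_function_zero[OF \<phi>] by auto
  show "integrable M (\<lambda>x. norm (grad \<phi> x) powr p)"
      "(LINT x|M. norm (grad \<phi> x) powr p) = (LINT x|lborel. norm (grad \<phi> x) powr p)"
    using *[OF test_function_integrable(2)[OF p \<phi>]] grad_eq_0_outside[OF \<phi>] by auto
qed

section \<open>Eigenvalues\<close>

text \<open>If \<open>b \<le> \<eta> * a\<close> the first term suffices, otherwise the second. The
  free parameter allows the weight of \<open>a powr p\<close> to be made small.\<close>

lemma young_powr:
  fixes a b \<eta> p :: real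
  assumes "1 < p" "0 \<le> a" "0 \<le> b" "0 < \<eta>"
  shows "a powr (p - 1) * b \<le> \<eta> * a powr p + \<eta> powr (1 - p) * b powr p"
proof (cases "b \<le> \<eta> * a")
  case True
  have "a powr (p - 1) * b \<le> a powr (p - 1) * (\<eta> * a)" using True by (intro mult_left_mono) auto
  also have "\<dots> = \<eta> * a powr p" using assms by (cases "a = 0") (auto simp: powr_diff)
  also have "\<dots> \<le> \<eta> * a powr p + \<eta> powr (1 - p) * b powr p" by simp
  finally show ?thesis .
next
  case False
  moreover have "0 \<le> \<eta> * a" using assms by simp
  ultimately have "0 < b" by linarith
  have "a \<le> b / \<eta>" using False assms by (simp add: field_simps)
  then have "a powr (p - 1) * b \<le> (b / \<eta>) powr (p - 1) * b"
    using assms by (intro mult_right_mono powr_mono2) auto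
  also have "\<dots> = \<eta> powr (1 - p) * b powr p"
    using assms \<open>0 < b\<close> by (simp add: powr_divide powr_diff)
  also have "\<dots> \<le> \<eta> * a powr p + \<eta> powr (1 - p) * b powr p" using assms by simp
  finally show ?thesis .
qed

lemma integrable_powr_diff:
  fixes f g :: "'a \<Rightarrow> 'b :: euclidean_space"
  assumes p: "0 < p" and [measurable]: "f \<in> borel_measurable M" "g \<in> borel_measurable M"
    and "integrable M (\<lambda>x. norm (f x) powr p)" "integrable M (\<lambda>x. norm (g x) powr p)"
  shows "integrable M (\<lambda>x. norm (f x - g x) powr p)"
proof (rule Bochner_Integration.integrable_bound)
  show "integrable M (\<lambda>x. 2 powr p * (norm (f x) powr p + norm (g x) powr p))"
    using assms by auto
  show "AE x in M. norm (norm (f x - g x) powr p) \<le> norm (2 powr p * (norm (f x) powr p + norm (g x) powr p))"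
  proof (intro AE_I2)
    fix x
    show "norm (norm (f x - g x) powr p) \<le> norm (2 powr p * (norm (f x) powr p + norm (g x) powr p))"
      using norm_add_powr_le[of p "f x" "- g x"] p by simp
  qed
qed measurable

text \<open>Pairing with \<open>|w|^(p-2) w\<close> is continuous on \<open>L^p\<close>, and pairing
  \<open>w\<close> itself gives the integral of \<open>|w|^p\<close>. Young's inequality with a
  parameter takes the place of Hoelder. Values in a Euclidean space cover both the eigenfunction and
  its gradient.\<close>

lemma duality_map_pairing_tendsto:
  fixes w :: "'a \<Rightarrow> 'b :: euclidean_space"
  assumes p: "1 < p" and [measurable]: "w \<in> borel_measurable M" "\<And>n. \<psi> n \<in> borel_measurable M"
    and w: "integrable M (\<lambda>x. norm (w x) powr p)"
    and \<psi>: "\<And>n. integrable M (\<lambda>x. norm (\<psi> n x - w x) powr p)"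
    and lim: "(\<lambda>n::nat. LINT x|M. norm (\<psi> n x - w x) powr p) \<longlonglongrightarrow> 0"
  shows "(\<lambda>n. LINT x|M. norm (w x) powr (p - 2) * (w x \<bullet> \<psi> n x)) \<longlonglongrightarrow> (LINT x|M. norm (w x) powr p)"
proof -
  define I where "I = (LINT x|M. norm (w x) powr p)"
  define J where "J = (\<lambda>n. LINT x|M. norm (\<psi> n x - w x) powr p)"
  have I0: "0 \<le> I" unfolding I_def by (intro integral_nonneg_AE) auto
  have J0: "0 \<le> J n" for n unfolding J_def by (intro integral_nonneg_AE) auto
  have pt: "\<bar>norm (w x) powr (p - 2) * (w x \<bullet> (\<psi> n x - w x))\<bar>
      \<le> \<eta> * norm (w x) powr p + \<eta> powr (1 - p) * norm (\<psi> n x - w x) powr p" if "0 < \<eta>" for \<eta> n x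
  proof -
    have "\<bar>norm (w x) powr (p - 2) * (w x \<bullet> (\<psi> n x - w x))\<bar> \<le> norm (w x) powr (p - 2) * (norm (w x) * norm (\<psi> n x - w x))"
      using Cauchy_Schwarz_ineq2 by (auto simp: abs_mult intro!: mult_left_mono)
    also have "\<dots> = norm (w x) powr (p - 1) * norm (\<psi> n x - w x)"
    proof (cases "w x = 0")
      case False
      then have "norm (w x) powr (p - 2) * norm (w x) = norm (w x) powr (p - 1)"
        using powr_add[of "norm (w x)" "p - 2" 1] by simp
      then show ?thesis by (simp flip: mult.assoc)
    qed simp
    also have "\<dots> \<le> \<eta> * norm (w x) powr p + \<eta> powr (1 - p) * norm (\<psi> n x - w x) powr p"
      using p that by (intro young_powr) auto
    finally show ?thesis .
  qed
  have int: "integrable M (\<lambda>x. norm (w x) powr (p - 2) * (w x \<bullet> (\<psi> n x - w x)))" for n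
  proof (rule Bochner_Integration.integrable_bound)
    show "integrable M (\<lambda>x. 1 * norm (w x) powr p + 1 powr (1 - p) * norm (\<psi> n x - w x) powr p)"
      using w \<psi> by (intro Bochner_Integration.integrable_add integrable_mult_right) auto
    show "AE x in M. norm (norm (w x) powr (p - 2) * (w x \<bullet> (\<psi> n x - w x)))
        \<le> norm (1 * norm (w x) powr p + 1 powr (1 - p) * norm (\<psi> n x - w x) powr p)"
      using pt[of 1] by (auto intro!: AE_I2)
  qed measurable
  \<comment> \<open>At zeros of \<open>w\<close> both sides vanish because
    \<open>0 powr a = 0\<close>, also for \<open>p < 2\<close>.\<close>
  have ww: "norm (w x) powr (p - 2) * (w x \<bullet> w x) = norm (w x) powr p" for x
    using powr_add[of "norm (w x)" "p - 2" 2] by (cases "w x = 0") (auto simp: dot_square_norm)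
  have split: "(LINT x|M. norm (w x) powr (p - 2) * (w x \<bullet> \<psi> n x)) = I + (LINT x|M. norm (w x) powr (p - 2) * (w x \<bullet> (\<psi> n x - w x)))" for n
  proof -
    have "norm (w x) powr (p - 2) * (w x \<bullet> \<psi> n x) = norm (w x) powr p + norm (w x) powr (p - 2) * (w x \<bullet> (\<psi> n x - w x))" for x
      by (simp add: inner_diff_right right_diff_distrib ww)
    then show ?thesis unfolding I_def using w int by simp
  qed
  have bound: "\<bar>LINT x|M. norm (w x) powr (p - 2) * (w x \<bullet> (\<psi> n x - w x))\<bar> \<le> \<eta> * I + \<eta> powr (1 - p) * J n"
    if "0 < \<eta>" for \<eta> n
  proof -
    have "norm (LINT x|M. norm (w x) powr (p - 2) * (w x \<bullet> (\<psi> n x - w x)))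
       \<le> (LINT x|M. \<eta> * norm (w x) powr p + \<eta> powr (1 - p) * norm (\<psi> n x - w x) powr p)"
      using pt[OF that, of _ n] w \<psi>[of n] int[of n]
      by (intro order_trans[OF integral_norm_bound integral_mono]) auto
    also have "\<dots> = \<eta> * I + \<eta> powr (1 - p) * J n"
      unfolding I_def J_def using w \<psi> by simp
    finally show ?thesis by simp
  qed
  have "(\<lambda>n. LINT x|M. norm (w x) powr (p - 2) * (w x \<bullet> (\<psi> n x - w x))) \<longlonglongrightarrow> 0"
  proof (rule LIMSEQ_I)
    fix e :: real assume e: "0 < e"
    \<comment> \<open>Makes the first term of \<open>bound\<close> less than \<open>e / 2\<close>,
      with \<open>I + 1\<close> guarding against \<open>I = 0\<close>. With \<open>\<eta>\<close>
      now fixed, the second term tends to zero.\<close>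
    define \<eta> where "\<eta> = e / (2 * (I + 1))"
    have \<eta>: "0 < \<eta>" "\<eta> * I < e / 2" using e I0 by (auto simp: \<eta>_def field_simps)
    have "(\<lambda>n. \<eta> powr (1 - p) * J n) \<longlonglongrightarrow> \<eta> powr (1 - p) * 0"
      using lim unfolding J_def by (intro tendsto_intros)
    then have "\<forall>\<^sub>F n in sequentially. \<eta> powr (1 - p) * J n < e / 2"
      using e by (intro order_tendstoD(2)) auto
    then obtain N where N: "\<And>n. n \<ge> N \<Longrightarrow> \<eta> powr (1 - p) * J n < e / 2"
      by (auto simp: eventually_sequentially)
    show "\<exists>no. \<forall>n\<ge>no. norm ((LINT x|M. norm (w x) powr (p - 2) * (w x \<bullet> (\<psi> n x - w x))) - 0) < e"
    proof (intro exI[of _ N] allI impI)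
      fix n assume "N \<le> n"
      from N[OF this] bound[OF \<eta>(1), of n] \<eta>(2)
      show "norm ((LINT x|M. norm (w x) powr (p - 2) * (w x \<bullet> (\<psi> n x - w x))) - 0) < e"
        by simp
    qed
  qed
  from tendsto_add[OF tendsto_const[of I] this] show ?thesis
    unfolding split by (simp add: I_def)
qed

text \<open>The eigenvalue equation and the Poincare inequality are available for test functions
  only; both pass to the eigenfunction through its approximants. The factor \<open>4 powr p\<close>
  comes from splitting a \<open>p\<close>-th power twice.\<close>

lemma eigenvalue_ge:
  fixes \<Omega> :: "(real ^ 'n) set"
  assumes p: "1 < p" and op: "open \<Omega>" and K: "0 < K"
    and poincare: "\<And>\<phi>. test_function \<Omega> \<phi> \<Longrightarrow>
      (LINT x|lborel. \<bar>\<phi> x\<bar> powr p) \<le> K * (LINT x|lborel. norm (grad \<phi> x) powr p)"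
    and l: "dirichlet_eigenvalue p \<Omega> l"
  shows "1 / (4 powr p * K) \<le> l"
proof -
  define M where "M = restrict_space lebesgue \<Omega>"
  have \<Omega>: "\<Omega> \<inter> space lebesgue \<in> sets lebesgue" using op by auto
  have LINT: "(LINT x:\<Omega>|lebesgue. f x) = (LINT x|M. f x)" for f :: "real ^ 'n \<Rightarrow> real"
    unfolding set_lebesgue_integral_def M_def by (rule integral_restrict_space[OF \<Omega>, symmetric])
  obtain u G where W: "W01p p \<Omega> u G" and u0: "\<not> (AE x in lebesgue. x \<in> \<Omega> \<longrightarrow> u x = 0)"
    and eq: "\<And>\<phi>. test_function \<Omega> \<phi> \<Longrightarrow> (LINT x|M. norm (G x) powr (p - 2) * (G x \<bullet> grad \<phi> x)) =
           l * (LINT x|M. \<bar>u x\<bar> powr (p - 2) * u x * \<phi> x)"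
    using l unfolding dirichlet_eigenvalue_def LINT by blast
  obtain \<phi> where \<phi>: "\<And>n. test_function \<Omega> (\<phi> n)"
    and lim_u: "(\<lambda>n::nat. LINT x|M. \<bar>\<phi> n x - u x\<bar> powr p) \<longlonglongrightarrow> 0"
    and lim_G: "(\<lambda>n::nat. LINT x|M. norm (grad (\<phi> n) x - G x) powr p) \<longlonglongrightarrow> 0"
    using W unfolding W01p_def LINT by blast
  have Lp: "f \<in> borel_measurable M \<and> integrable M (\<lambda>x. norm (f x) powr p)" if "Lp_on p \<Omega> f"
    for f :: "real ^ 'n \<Rightarrow> 'b :: euclidean_space"
    using that unfolding Lp_on_def set_borel_measurable_def set_integrable_def M_def
      integrable_restrict_space[OF \<Omega>] borel_measurable_restrict_space_iff[OF \<Omega>] by simp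
  have um [measurable]: "u \<in> borel_measurable M" and ui: "integrable M (\<lambda>x. \<bar>u x\<bar> powr p)"
    and Gm [measurable]: "G \<in> borel_measurable M" and Gi: "integrable M (\<lambda>x. norm (G x) powr p)"
    using W Lp[of u] Lp[of G] by (auto simp: W01p_def W1p_def)
  have p0: "0 < p" using p by simp
  note test = test_function_restrict[OF p0 \<phi> op, folded M_def]
  note [measurable] = test(1,2)
  have du: "integrable M (\<lambda>x. \<bar>\<phi> n x - u x\<bar> powr p)" for n
    using integrable_powr_diff[OF p0 test(1)[of n] um] test(3)[of n] ui by simp
  have dG: "integrable M (\<lambda>x. norm (grad (\<phi> n) x - G x) powr p)" for n
    using integrable_powr_diff[OF p0 test(2)[of n] Gm] test(4)[of n] Gi by simp
  let ?U = "LINT x|M. \<bar>u x\<bar> powr p" and ?G = "LINT x|M. norm (G x) powr p"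
  \<comment> \<open>Both sides of the equation tested with \<open>\<phi> n\<close> converge, which
    gives the energy identity.\<close>
  have "(\<lambda>n. LINT x|M. norm (G x) powr (p - 2) * (G x \<bullet> grad (\<phi> n) x)) \<longlonglongrightarrow> ?G"
    using duality_map_pairing_tendsto[OF p Gm test(2) Gi dG lim_G] .
  moreover have "(\<lambda>n. LINT x|M. \<bar>u x\<bar> powr (p - 2) * u x * \<phi> n x) \<longlonglongrightarrow> ?U"
    using duality_map_pairing_tendsto[OF p um test(1)] ui du lim_u by (simp add: mult.assoc)
  then have "(\<lambda>n. l * (LINT x|M. \<bar>u x\<bar> powr (p - 2) * u x * \<phi> n x)) \<longlonglongrightarrow> l * ?U"
    by (intro tendsto_intros)
  ultimately have energy: "?G = l * ?U"
    unfolding eq[OF \<phi>] by (rule LIMSEQ_unique)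
  \<comment> \<open>Pass from \<open>u\<close> to \<open>\<phi> n\<close>, apply the Poincare
    inequality, and return from \<open>grad (\<phi> n)\<close> to \<open>G\<close>; the errors
    vanish in the limit.\<close>
  have bound: "?U \<le> 2 powr p * (K * (2 powr p * (?G + (LINT x|M. norm (grad (\<phi> n) x - G x) powr p)))
      + (LINT x|M. \<bar>\<phi> n x - u x\<bar> powr p))" for n
  proof -
    have "?U \<le> (LINT x|M. 2 powr p * (\<bar>\<phi> n x\<bar> powr p + \<bar>\<phi> n x - u x\<bar> powr p))"
    proof (intro integral_mono ui)
      show "integrable M (\<lambda>x. 2 powr p * (\<bar>\<phi> n x\<bar> powr p + \<bar>\<phi> n x - u x\<bar> powr p))"
        using du[of n] test(3)[of n] by auto
      show "\<bar>u x\<bar> powr p \<le> 2 powr p * (\<bar>\<phi> n x\<bar> powr p + \<bar>\<phi> n x - u x\<bar> powr p)" for x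
        using norm_add_powr_le[of p "\<phi> n x" "u x - \<phi> n x"] p by (simp add: abs_minus_commute)
    qed
    also have "\<dots> = 2 powr p * ((LINT x|M. \<bar>\<phi> n x\<bar> powr p) + (LINT x|M. \<bar>\<phi> n x - u x\<bar> powr p))"
      using du[of n] test(3)[of n] by simp
    also have "(LINT x|M. \<bar>\<phi> n x\<bar> powr p) \<le> K * (LINT x|M. norm (grad (\<phi> n) x) powr p)"
      using poincare[OF \<phi>] by (simp add: test(5,6))
    also have "(LINT x|M. norm (grad (\<phi> n) x) powr p)
        \<le> (LINT x|M. 2 powr p * (norm (G x) powr p + norm (grad (\<phi> n) x - G x) powr p))"
    proof (intro integral_mono test(4))
      show "integrable M (\<lambda>x. 2 powr p * (norm (G x) powr p + norm (grad (\<phi> n) x - G x) powr p))"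
        using dG[of n] Gi by auto
      show "norm (grad (\<phi> n) x) powr p \<le> 2 powr p * (norm (G x) powr p + norm (grad (\<phi> n) x - G x) powr p)" for x
        using norm_add_powr_le[of p "G x" "grad (\<phi> n) x - G x"] p by simp
    qed
    also have "\<dots> = 2 powr p * (?G + (LINT x|M. norm (grad (\<phi> n) x - G x) powr p))"
      using dG[of n] Gi by simp
    finally show ?thesis using K by simp
  qed
  have "(\<lambda>n. 2 powr p * (K * (2 powr p * (?G + (LINT x|M. norm (grad (\<phi> n) x - G x) powr p)))
      + (LINT x|M. \<bar>\<phi> n x - u x\<bar> powr p))) \<longlonglongrightarrow> 2 powr p * (K * (2 powr p * (?G + 0)) + 0)"
    by (intro tendsto_intros lim_u lim_G)
  then have "?U \<le> 2 powr p * (K * (2 powr p * (?G + 0)) + 0)"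
    by (rule LIMSEQ_le_const) (use bound in blast)
  also have "\<dots> = (2 powr p * 2 powr p) * K * ?G" by simp
  also have "2 powr p * 2 powr p = (4 :: real) powr p"
    by (simp flip: powr_mult)
  finally have le: "?U \<le> 4 powr p * K * l * ?U" unfolding energy by simp
  \<comment> \<open>An eigenfunction is not almost everywhere zero, so \<open>?U\<close> can be
    cancelled.\<close>
  have "?U \<noteq> 0"
  proof
    assume "?U = 0"
    then have "AE x in M. \<bar>u x\<bar> powr p = 0"
      using ui by (subst (asm) integral_nonneg_eq_0_iff_AE) auto
    then have "AE x in lebesgue. x \<in> \<Omega> \<longrightarrow> u x = 0"
      unfolding M_def using \<Omega> by (subst (asm) AE_restrict_space_iff) auto
    with u0 show False by simp
  qed
  moreover have "0 \<le> ?U" by (intro integral_nonneg_AE) auto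
  ultimately have "0 < ?U" by (metis less_eq_real_def)
  then have "1 \<le> 4 powr p * K * l"
    using le mult_right_le_imp_le[of 1 ?U "4 powr p * K * l"] by simp
  then show ?thesis using K by (simp add: field_simps)
qed

theorem theorem1p4p2:
  fixes p :: real
  assumes "1 < p" and "p > real CARD('n) - 1"
  shows "\<exists>C>0. \<forall>\<Omega> :: (real ^ 'n::finite) set.
           domain \<Omega> \<and> bounded \<Omega> \<and> connected (frontier \<Omega>) \<longrightarrow>
           first_eigenvalue p \<Omega> \<ge> ereal (C * inradius \<Omega> powr (- p))"
proof -
  obtain K where K: "0 < K" and poincare: "\<And>(\<Omega> :: (real ^ 'n) set) \<phi>. domain \<Omega> \<Longrightarrow> bounded \<Omega> \<Longrightarrow>
      connected (frontier \<Omega>) \<Longrightarrow> test_function \<Omega> \<phi> \<Longrightarrow>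
    (\<integral>\<^sup>+x. ennreal (\<bar>\<phi> x\<bar> powr p) \<partial>lborel)
      \<le> ennreal (K * inradius \<Omega> powr p) * (\<integral>\<^sup>+x. ennreal (norm (grad \<phi> x) powr p) \<partial>lborel)"
    using poincare_inradius[OF assms] by blast
  show ?thesis
  proof (intro exI[of _ "1 / (4 powr p * K)"] conjI allI impI, goal_cases)
    case 1
    then show ?case using K by simp
  next
    case (2 \<Omega>)
    then have \<Omega>: "domain \<Omega>" "bounded \<Omega>" "connected (frontier \<Omega>)" by auto
    let ?\<rho> = "inradius \<Omega>"
    have rho: "0 < ?\<rho>" using \<Omega> by (intro inradius_pos)
    have "1 / (4 powr p * (K * ?\<rho> powr p)) \<le> l" if "dirichlet_eigenvalue p \<Omega> l" for l
    proof (rule eigenvalue_ge[OF assms(1) _ _ _ that])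
      fix \<phi> assume \<phi>: "test_function \<Omega> \<phi>"
      have p0: "0 < p" using assms by simp
      have "ennreal (LINT x|lborel. \<bar>\<phi> x\<bar> powr p) \<le> ennreal (K * ?\<rho> powr p) * ennreal (LINT x|lborel. norm (grad \<phi> x) powr p)"
        using poincare[OF \<Omega> \<phi>] test_function_integrable[OF p0 \<phi>] by (simp add: nn_integral_eq_integral)
      then show "(LINT x|lborel. \<bar>\<phi> x\<bar> powr p) \<le> K * ?\<rho> powr p * (LINT x|lborel. norm (grad \<phi> x) powr p)"
        using K by (simp add: integral_nonneg_AE flip: ennreal_mult)
    qed (use \<Omega> K rho in \<open>auto simp: domain_def\<close>)
    \<comment> \<open>A lower bound for every eigenvalue bounds their infimum.\<close>
    then show ?case
      unfolding first_eigenvalue_def using rho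
      by (intro INF_greatest) (simp add: powr_minus divide_simps mult_ac)
  qed
qed

end
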